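(* Let $R$ be a non-local finite commutative ring with unity. Then the upper ideal relation graph $\Gamma_U(R)$ is a planar graph if and only if $R$ is isomorphic to one of the following $9$ rings: $\mathbb{Z}_2 \times \mathbb{Z}_2 \times \mathbb{Z}_2$, $\mathbb{Z}_2 \times \mathbb{Z}_4$, $\mathbb{Z}_2 \times \frac{\mathbb{Z}_2[x]}{(x^2)}$, $\mathbb{Z}_2 \times \mathbb{F}_4$, $\mathbb{Z}_2 \times \mathbb{Z}_2$, $\mathbb{Z}_2 \times \mathbb{Z}_3$, $\mathbb{Z}_3 \times \mathbb{Z}_3$, $\mathbb{Z}_3 \times \mathbb{F}_4$, $\mathbb{F}_4 \times \mathbb{F}_4$.
   Context: Rings have a unity. A ring is local if it has a unique maximal ideal; a non-local finite commutative ring is (up to isomorphism) a direct product $R_1\times\cdots\times R_n$ of finite commutative local rings with $n\ge 2$. For $x\in R$, $(x)$ is the ideal generated by $x$. The upper ideal relation graph $\Gamma_U(R)$ is the simple undirected graph whose vertex set is the set of all non-unit elements of $R$ (including $0$), where two distinct vertices $x,y$ are adjacent if and only if there exists a non-unit $z\in R$ with $(x)\subseteq (z)$ and $(y)\subseteq (z)$. $\mathbb{F}_q$ denotes the field with $q$ elements. A graph is planar if it can be drawn in the plane without edge crossings (equivalently, it contains no subdivision of $K_5$ or $K_{3,3}$). *)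

theory Defs
  imports "HOL-Analysis.Analysis" "HOL-Algebra.Algebra" "HOL-Number_Theory.Residues"
begin

section \<open>Planar graphs\<close>

text \<open>A simple undirected graph is a pair \<open>(V, E)\<close> of a vertex set and a set of two-element
  subsets of \<open>V\<close>.  A drawing places the vertices at distinct points of the plane \<open>\<complex>\<close> and
  represents every edge by an arc (an injective path) joining its end points; an arc contains no
  vertex other than its end points, and two arcs meet only at common end points.\<close>

definition plane_drawing ::
  "'a set \<times> 'a set set \<Rightarrow> ('a \<Rightarrow> complex) \<Rightarrow> ('a set \<Rightarrow> real \<Rightarrow> complex) \<Rightarrow> bool"
  where "plane_drawing G p \<gamma> \<longleftrightarrow>
    inj_on p (fst G) \<and>
    (\<forall>e\<in>snd G. arc (\<gamma> e) \<and> {pathstart (\<gamma> e), pathfinish (\<gamma> e)} = p ` e \<and>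
                path_image (\<gamma> e) \<inter> p ` fst G \<subseteq> p ` e) \<and>
    (\<forall>e\<in>snd G. \<forall>f\<in>snd G. e \<noteq> f \<longrightarrow>
                path_image (\<gamma> e) \<inter> path_image (\<gamma> f) \<subseteq> p ` (e \<inter> f))"

definition planar :: "'a set \<times> 'a set set \<Rightarrow> bool"
  where "planar G \<longleftrightarrow> (\<exists>p \<gamma>. plane_drawing G p \<gamma>)"

section \<open>The upper ideal relation graph\<close>

definition local_ring :: "('a, 'm) ring_scheme \<Rightarrow> bool"
  where "local_ring R \<longleftrightarrow> (\<exists>!M. maximalideal M R)"

definition nonunits :: "('a, 'm) ring_scheme \<Rightarrow> 'a set"
  where "nonunits R = carrier R - Units R"

definition upper_ideal_relation_graph :: "('a, 'm) ring_scheme \<Rightarrow> 'a set \<times> 'a set set"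
  where "upper_ideal_relation_graph R =
    (nonunits R,
     {{x, y} | x y. x \<in> nonunits R \<and> y \<in> nonunits R \<and> x \<noteq> y \<and>
        (\<exists>z\<in>nonunits R. Idl\<^bsub>R\<^esub> {x} \<subseteq> Idl\<^bsub>R\<^esub> {z} \<and> Idl\<^bsub>R\<^esub> {y} \<subseteq> Idl\<^bsub>R\<^esub> {z})})"

section \<open>The rings in the classification\<close>

text \<open>\<open>Rupt\<close> is the quotient of the polynomial ring by the principal ideal of the given polynomial,
  and polynomials are lists of coefficients, leading coefficient first.  So \<open>[1, 0, 0]\<close> is
  \<open>x\<^sup>2\<close> and \<open>[1, 1, 1]\<close> is \<open>x\<^sup>2 + x + 1\<close>.\<close>

definition Z2_dual :: "int list set ring"
  where "Z2_dual = Rupt\<^bsub>residue_ring 2\<^esub> (carrier (residue_ring 2)) [1, 0, 0]"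

definition F4 :: "int list set ring"
  where "F4 = Rupt\<^bsub>residue_ring 2\<^esub> (carrier (residue_ring 2)) [1, 1, 1]"

text \<open>\<open>F4\<close> is the field with four elements.\<close>

lemma F4_field_order: "field F4" "order F4 = 4"
proof -
  let ?R = "residue_ring 2"
  let ?P = "(carrier ?R)[X]\<^bsub>?R\<^esub>"
  interpret Z: residues_prime 2 ?R
    by unfold_locales auto
  have ops: "x \<otimes>\<^bsub>?R\<^esub> y = x * y mod 2" "x \<oplus>\<^bsub>?R\<^esub> y = (x + y) mod 2" "\<zero>\<^bsub>?R\<^esub> = 0" for x y
    by (simp_all add: residue_ring_def)
  note sub = Z.carrier_is_subfield
  have poly: "[1, 1, 1] \<in> carrier ?P"
    by (simp add: univ_poly_def polynomial_def residue_ring_def)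
  have small: "q = [] \<or> q = [1] \<or> q = [1, 0] \<or> q = [1, 1]"
    if "q \<in> carrier ?P" "length q \<le> 2" for q
  proof -
    have bit: "a = 0 \<or> a = 1" if "a \<in> carrier ?R" for a
      using that by (auto simp: residue_ring_def)
    from that(2) consider "q = []" | a where "q = [a]" | a b where "q = [a, b]"
      by (cases q; cases "tl q"; auto)
    then show ?thesis
      using that(1) bit
      by cases (auto simp: univ_poly_def polynomial_def residue_ring_def)
  qed
  have "{q \<in> carrier ?P. length q \<le> degree [1, 1, 1 :: int]} = {[], [1], [1, 0], [1, 1]}"
    (is "?A = ?B")
  proof
    show "?A \<subseteq> ?B"
      using small by fastforce
    show "?B \<subseteq> ?A"
      by (auto simp: univ_poly_def polynomial_def residue_ring_def)
  qed
  then have mods: "(\<lambda>q. Z.pmod q [1, 1, 1]) ` carrier ?P = {[], [1], [1, 0], [1, 1]}"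
    using Z.pmod_image_characterization[OF sub poly] by simp
  have "card (carrier F4) = card {[], [1], [1, 0], [1, 1 :: int]}"
    using Z.rupture_carrier_as_pmod_image[OF sub poly] Z.rupture_surj_inj_on[OF sub poly]
    unfolding mods F4_def by (metis card_image)
  then show "order F4 = 4"
    by (simp add: order_def)

  have units: "Units ?P = {[k] | k. k \<in> carrier ?R - {\<zero>\<^bsub>?R\<^esub>}}"
    using Z.univ_poly_units[OF sub] .
  have one: "[1] \<in> Units ?P"
    unfolding units by (simp add: residue_ring_def)
  have "pirreducible\<^bsub>?R\<^esub> (carrier ?R) [1, 1, 1]"
  proof (rule Z.pirreducibleI[OF subfieldE(1)[OF sub] poly])
    show "[1, 1, 1] \<notin> Units ?P"
      by (simp add: units)
    fix q r assume qr: "q \<in> carrier ?P" "r \<in> carrier ?P" "[1, 1, 1] = q \<otimes>\<^bsub>?P\<^esub> r"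
    then have eq: "[1, 1, 1] = Z.poly_mult q r"
      by (simp add: univ_poly_mult)
    have ne: "q \<noteq> []" "r \<noteq> []"
      using eq Z.poly_mult_zero qr by (auto simp: univ_poly_carrier[symmetric] Z.polynomial_in_carrier[OF subfieldE(1)[OF sub]])
    have "degree q + degree r = 2"
      using Z.poly_mult_degree_eq[OF subfieldE(1)[OF sub], of q r] qr(1,2) ne eq[symmetric]
      by (simp add: univ_poly_carrier)
    then consider "degree q = 0" | "degree r = 0" | "degree q = 1" "degree r = 1"
      by linarith
    then show "q \<in> Units ?P \<or> r \<in> Units ?P"
    proof cases
      case 1
      then have "q = [1]" using small[OF qr(1)] ne by auto
      then show ?thesis using one by simp
    next
      case 2
      then have "r = [1]" using small[OF qr(2)] ne by auto
      then show ?thesis using one by simp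
    next
      case 3
      then have "length q = 2" "length r = 2"
        by linarith+
      then have "q = [1, 0] \<or> q = [1, 1]" "r = [1, 0] \<or> r = [1, 1]"
        using small[OF qr(1)] small[OF qr(2)] ne by auto
      then show ?thesis
        using eq by (elim disjE) (simp_all add: ops)
    qed
  qed simp
  then show "field F4"
    unfolding F4_def by (simp add: Z.rupture_is_field_iff_pirreducible[OF sub poly])
qed

end

theory Submission
  imports Defs "HOL-Complex_Analysis.Winding_Numbers"
begin

text \<open>Every proper principal ideal spans a complete subgraph of \<open>\<Gamma>\<^sub>U(R)\<close>, so planarity forces all of
  them to have at most four elements.  A non-local finite ring has a nontrivial idempotent and
  hence is a product \<open>S \<times> T\<close>.  The ideals of \<open>(1, 0)\<close> and \<open>(0, 1)\<close> bound the orders of \<open>S\<close> and \<open>T\<close>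
  by four, and the ideal of \<open>(1, t)\<close> for a nonzero nonunit \<open>t\<close> of \<open>T\<close> forces \<open>|S| = 2\<close>.  The rings of order
  at most four then leave exactly the nine products, whose graphs embed in unions of copies of \<open>K\<^sub>4\<close>
  that can be drawn with straight edges.  In particular \<open>K\<^sub>5\<close> is the only obstruction needed.

  For \<open>K\<^sub>5\<close>: in a drawing of \<open>K\<^sub>4\<close> some vertex \<open>d\<close> lies inside the triangle \<open>abc\<close> of the others.
  A fifth vertex \<open>e\<close> joined to \<open>d\<close> is inside \<open>abc\<close> too, and by additivity of winding numbers it is
  inside one of the triangles \<open>abd\<close>, \<open>bcd\<close>, \<open>cad\<close>, say \<open>abd\<close>; then so is its neighbour \<open>c\<close>, which is
  impossible because \<open>abd\<close> lies in the closed disc bounded by \<open>abc\<close>.\<close>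

section \<open>The complete graph on five vertices\<close>

text \<open>An arc is injective, so deleting its starting point leaves the continuous image of the
  interval \<open>{0<..1}\<close>.\<close>

lemma arc_minus_pathstart_connected:
  assumes "arc g"
  shows "connected (path_image g - {pathstart g})"
proof -
  have inj: "inj_on g {0..1}"
    using assms by (simp add: arc_def)
  have "path_image g - {pathstart g} = g ` ({0..1} - {0})"
    using inj_on_image_set_diff[OF inj, of "{0..1}" "{0}"] by (simp add: path_image_def pathstart_def)
  also have "{0..1} - {0} = {0<..1::real}"
    by auto
  finally have "path_image g - {pathstart g} = g ` {0<..1}" .
  moreover have "connected (g ` {0<..1})"
    using assms by (intro connected_continuous_image)
      (auto simp: arc_def path_def intro: continuous_on_subset)
  ultimately show ?thesis by simp
qed

lemma connected_subset_frontier_disjoint: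
  assumes "connected S" "S \<inter> T \<noteq> {}" "S \<inter> frontier T = {}"
  shows "S \<subseteq> T"
  using connected_Int_frontier[of S T] assms by blast

lemma inside_or_outside: "q \<notin> S \<Longrightarrow> q \<in> inside S \<or> q \<in> outside S"
  using inside_Un_outside[of S] by blast

text \<open>The part of a plane drawing that concerns a clique \<open>K\<close>. Arcs are indexed by
  unordered edges, so \<open>ends\<close> cannot say which end point comes first.\<close>

locale drawn_clique =
  fixes K :: "'a set" and p :: "'a \<Rightarrow> complex" and \<gamma> :: "'a set \<Rightarrow> real \<Rightarrow> complex"
  assumes inj: "inj_on p K"
    and arc: "\<lbrakk>x \<in> K; y \<in> K; x \<noteq> y\<rbrakk> \<Longrightarrow> arc (\<gamma> {x, y})"
    and ends: "\<lbrakk>x \<in> K; y \<in> K; x \<noteq> y\<rbrakk> \<Longrightarrow>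
      {pathstart (\<gamma> {x, y}), pathfinish (\<gamma> {x, y})} = {p x, p y}"
    and vertices: "\<lbrakk>x \<in> K; y \<in> K; x \<noteq> y\<rbrakk> \<Longrightarrow> path_image (\<gamma> {x, y}) \<inter> p ` K \<subseteq> {p x, p y}"
    and meet: "\<lbrakk>x \<in> K; y \<in> K; x \<noteq> y; u \<in> K; v \<in> K; u \<noteq> v; {x, y} \<noteq> {u, v}\<rbrakk> \<Longrightarrow>
      path_image (\<gamma> {x, y}) \<inter> path_image (\<gamma> {u, v}) \<subseteq> p ` ({x, y} \<inter> {u, v})"
begin

section \<open>Sides, their orientations and triangles of a drawn clique\<close>

definition side :: "'a \<Rightarrow> 'a \<Rightarrow> complex set"
  where "side x y = path_image (\<gamma> {x, y})"

text \<open>The arc of an edge may run either way; \<open>dir\<close> reverses it when needed, so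
  that sides can be joined to a closed path and a side traversed backwards changes the sign of its
  winding number.\<close>

definition dir :: "'a \<Rightarrow> 'a \<Rightarrow> real \<Rightarrow> complex"
  where "dir x y = (if pathstart (\<gamma> {x, y}) = p x then \<gamma> {x, y} else reversepath (\<gamma> {x, y}))"

definition tri :: "'a \<Rightarrow> 'a \<Rightarrow> 'a \<Rightarrow> complex set"
  where "tri x y z = side x y \<union> side y z \<union> side z x"

lemma side_commute: "side x y = side y x"
  by (simp add: side_def insert_commute)

lemma tri_rotate: "tri x y z = tri y z x"
  by (auto simp: tri_def)

lemma dir:
  assumes "x \<in> K" "y \<in> K" "x \<noteq> y"
  shows "arc (dir x y)" "pathstart (dir x y) = p x" "pathfinish (dir x y) = p y"
    "path_image (dir x y) = side x y"
  using arc[OF assms] ends[OF assms]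
  by (auto simp: dir_def side_def arc_reversepath doubleton_eq_iff)

lemma dir_reverse:
  assumes "x \<in> K" "y \<in> K" "x \<noteq> y"
  shows "dir y x = reversepath (dir x y)"
proof -
  have "p x \<noteq> p y"
    using assms inj by (auto simp: inj_on_def)
  then show ?thesis
    using ends[OF assms] by (auto simp: dir_def insert_commute[of y x] doubleton_eq_iff)
qed

lemma vertex_in_side:
  assumes "x \<in> K" "y \<in> K" "x \<noteq> y" "v \<in> K"
  shows "p v \<in> side x y \<longleftrightarrow> v = x \<or> v = y"
proof -
  have "p x \<in> side x y" "p y \<in> side x y"
    using dir[OF assms(1-3)] by (metis pathstart_in_path_image pathfinish_in_path_image)+
  moreover have "side x y \<inter> p ` K \<subseteq> {p x, p y}"
    using vertices[OF assms(1-3)] by (simp add: side_def)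
  ultimately show ?thesis
    using assms inj by (auto simp: inj_on_def)
qed

lemma side_meet:
  assumes "x \<in> K" "y \<in> K" "x \<noteq> y" "u \<in> K" "v \<in> K" "u \<noteq> v" "{x, y} \<noteq> {u, v}"
  shows "side x y \<inter> side u v \<subseteq> p ` ({x, y} \<inter> {u, v})"
  using meet[OF assms] by (simp add: side_def)

lemma connected_side:
  assumes "x \<in> K" "y \<in> K" "x \<noteq> y"
  shows "connected (side x y)"
  using arc[OF assms] by (simp add: side_def connected_arc_image)

text \<open>Two sides of a triangle meet only in their common vertex, so going once around it is a
  simple closed path and the Jordan curve theorem applies.\<close>

lemma loop:
  assumes "{x, y, z} \<subseteq> K" "distinct [x, y, z]"
  defines "g \<equiv> dir x y +++ (dir y z +++ dir z x)"
  shows "simple_path g" "path_image g = tri x y z" "pathfinish g = pathstart g"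
proof -
  have yz: "arc (dir y z +++ dir z x)"
    using assms side_meet[of y z z x]
    by (intro arc_join) (auto simp: dir doubleton_eq_iff)
  have im: "path_image (dir y z +++ dir z x) = side y z \<union> side z x"
    using assms(1,2) by (auto simp: path_image_join dir)
  show "simple_path g"
    unfolding g_def
    using assms yz side_meet[of x y y z] side_meet[of x y z x]
    by (intro simple_path_join_loop) (auto simp: dir im doubleton_eq_iff)
  show "path_image g = tri x y z"
    unfolding g_def using assms(1,2) im by (auto simp: path_image_join dir tri_def)
  show "pathfinish g = pathstart g"
    unfolding g_def using assms(1,2) by (auto simp: dir)
qed

lemma Jordan:
  assumes "{x, y, z} \<subseteq> K" "distinct [x, y, z]"
  shows "inside (tri x y z) \<noteq> {}" "open (inside (tri x y z))" "connected (inside (tri x y z))"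
    "connected (outside (tri x y z))" "open (outside (tri x y z))"
    "bounded (inside (tri x y z))" "\<not> bounded (outside (tri x y z))"
    "frontier (inside (tri x y z)) = tri x y z" "frontier (outside (tri x y z)) = tri x y z"
  using Jordan_inside_outside[OF loop(1,3)[OF assms]] unfolding loop(2)[OF assms] by blast+

lemma vertex_in_tri:
  assumes "{x, y, z} \<subseteq> K" "distinct [x, y, z]" "v \<in> K"
  shows "p v \<in> tri x y z \<longleftrightarrow> v \<in> {x, y, z}"
  using assms by (auto simp: tri_def vertex_in_side)

text \<open>The edge \<open>u v\<close> has no vertex in common with the triangle. It is connected
  and avoids the triangle, so it cannot leave the inside.\<close>

lemma same_side:
  assumes "{x, y, z, u, v} \<subseteq> K" "distinct [x, y, z, u, v]" "p u \<in> inside (tri x y z)"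
  shows "p v \<in> inside (tri x y z)"
proof -
  have "side u v \<inter> tri x y z = {}"
    using assms(1,2) side_meet[of u v x y] side_meet[of u v y z] side_meet[of u v z x]
    by (auto simp: tri_def doubleton_eq_iff)
  moreover have "p u \<in> side u v"
    using assms by (auto simp: vertex_in_side)
  ultimately have "side u v \<subseteq> inside (tri x y z)"
    using assms
    by (intro connected_subset_frontier_disjoint connected_side) (auto simp: Jordan)
  then show ?thesis
    using assms by (auto simp: vertex_in_side subset_iff)
qed

text \<open>The winding number of a simple closed path has modulus 1 inside and is 0 outside, and it
  is additive over the sides. Testing only for nonzero values serves both orientations.\<close>

lemma winding_tri:
  assumes "{x, y, z} \<subseteq> K" "distinct [x, y, z]" "q \<notin> tri x y z"
  defines "w \<equiv> winding_number (dir x y) q + winding_number (dir y z) q + winding_number (dir z x) q"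
  shows "q \<in> inside (tri x y z) \<longleftrightarrow> w \<noteq> 0"
proof -
  define g where "g = dir x y +++ (dir y z +++ dir z x)"
  note g = loop[OF assms(1,2), folded g_def]
  have "winding_number g q = w"
    unfolding g_def w_def using assms(1-3)
    by (auto simp: winding_number_join path_image_join arc_imp_path dir tri_def)
  moreover have "norm (winding_number g q) = 1" if "q \<in> inside (tri x y z)"
    using simple_closed_path_norm_winding_number_inside[of g q] g that by simp
  moreover have "winding_number g q = 0" if "q \<in> outside (tri x y z)"
    using winding_number_zero_in_outside[of g q] g that by (simp add: simple_path_imp_path)
  ultimately show ?thesis
    using inside_or_outside[OF assms(3)] by fastforce
qed

text \<open>The boundary of a tetrahedron is a cycle with zero boundary, so the signed winding numbers
  of the four triangles around a point cancel.\<close>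

lemma inside_another_triangle:
  assumes "{a, b, c, d} \<subseteq> K" "distinct [a, b, c, d]"
    and "q \<notin> side a b \<union> side b c \<union> side c a \<union> side a d \<union> side b d \<union> side c d"
    and "q \<in> inside (tri a b c)"
  shows "q \<in> inside (tri a b d) \<or> q \<in> inside (tri b c d) \<or> q \<in> inside (tri c a d)"
proof (rule ccontr)
  assume "\<not> ?thesis"
  then have "q \<notin> inside (tri a b d)" "q \<notin> inside (tri b c d)" "q \<notin> inside (tri c a d)"
    by auto
  moreover have "q \<notin> tri a b c" "q \<notin> tri a b d" "q \<notin> tri b c d" "q \<notin> tri c a d"
    using assms(3) by (auto simp: tri_def side_commute)
  moreover have rev: "winding_number (dir y x) q = - winding_number (dir x y) q"
    if "x \<in> K" "y \<in> K" "x \<noteq> y" "q \<notin> side x y" for x y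
    using that by (simp add: dir_reverse[of x y] winding_number_reversepath arc_imp_path dir)
  ultimately have zero:
    "winding_number (dir a b) q + winding_number (dir b d) q + winding_number (dir d a) q = 0"
    "winding_number (dir b c) q + winding_number (dir c d) q + winding_number (dir d b) q = 0"
    "winding_number (dir c a) q + winding_number (dir a d) q + winding_number (dir d c) q = 0"
    and "winding_number (dir a b) q + winding_number (dir b c) q + winding_number (dir c a) q \<noteq> 0"
    using assms(1,2,4) winding_tri[of a b c q] winding_tri[of a b d q] winding_tri[of b c d q]
      winding_tri[of c a d q]
    by auto
  moreover have "winding_number (dir a b) q + winding_number (dir b c) q + winding_number (dir c a) q =
      (winding_number (dir a b) q + winding_number (dir b d) q + winding_number (dir d a) q) +
      (winding_number (dir b c) q + winding_number (dir c d) q + winding_number (dir d b) q) +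
      (winding_number (dir c a) q + winding_number (dir a d) q + winding_number (dir d c) q)"
    using rev[of a d] rev[of b d] rev[of c d] assms(1-3) by auto
  ultimately show False
    unfolding zero by simp
qed

text \<open>The edge from \<open>d\<close> to a corner \<open>x\<close> meets the triangle only in
  that corner. Without the corner it is still connected and avoids the triangle, which is the
  frontier of both regions, so it stays in the region of \<open>p d\<close>.\<close>

lemma half_open_side:
  assumes "{a, b, c, d} \<subseteq> K" "distinct [a, b, c, d]" "x \<in> {a, b, c}"
    and "T = inside (tri a b c) \<or> T = outside (tri a b c)" "p d \<in> T"
  shows "side x d - {p x} \<subseteq> T"
proof (rule connected_subset_frontier_disjoint)
  show "connected (side x d - {p x})"
    using arc_minus_pathstart_connected[of "dir x d"] assms by (auto simp: dir)
  have "p d \<in> side x d" "p d \<noteq> p x"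
    using assms inj by (auto simp: vertex_in_side inj_on_def)
  then show "(side x d - {p x}) \<inter> T \<noteq> {}"
    using assms(5) by blast
  have "side x d \<inter> tri a b c \<subseteq> {p x}"
    using assms(1-3) side_meet[of x d a b] side_meet[of x d b c] side_meet[of x d c a]
    by (auto simp: tri_def doubleton_eq_iff)
  then show "(side x d - {p x}) \<inter> frontier T = {}"
    using assms(1,2,4) by (auto simp: Jordan)
qed

text \<open>If \<open>d\<close> is not inside, it is outside, and so are its edges to
  \<open>a\<close> and \<open>b\<close> apart from these corners; the third side of
  \<open>tri a b d\<close> lies on \<open>tri a b c\<close> itself.\<close>

lemma inside_disjoint_tri:
  assumes "{a, b, c, d} \<subseteq> K" "distinct [a, b, c, d]" "p d \<notin> inside (tri a b c)"
  shows "inside (tri a b c) \<inter> tri a b d = {}"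
proof -
  have out: "p d \<in> outside (tri a b c)"
    using inside_or_outside[of "p d" "tri a b c"] vertex_in_tri[of a b c d] assms by auto
  have "side a d - {p a} \<subseteq> outside (tri a b c)" "side b d - {p b} \<subseteq> outside (tri a b c)"
    using half_open_side[OF assms(1,2) _ _ out] by auto
  moreover have "p a \<in> tri a b c" "p b \<in> tri a b c" "side a b \<subseteq> tri a b c"
    using assms(1,2) by (auto simp: tri_def vertex_in_side)
  ultimately show ?thesis
    using inside_Int_outside[of "tri a b c"] inside_no_overlap[of "tri a b c"]
    unfolding tri_def[of a b d] side_commute[of d] by blast
qed

text \<open>Each region is connected and misses the boundary of the other. If they met, each would
  contain the other and the boundaries would agree; but \<open>p c\<close> lies on only one of
  them.\<close>

lemma insides_disjoint:
  assumes "{a, b, c, d} \<subseteq> K" "distinct [a, b, c, d]"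
    and "p d \<notin> inside (tri a b c)" "p c \<notin> inside (tri a b d)"
  shows "inside (tri a b c) \<inter> inside (tri a b d) = {}"
proof (rule ccontr)
  assume ne: "\<not> ?thesis"
  have K: "{a, b, c} \<subseteq> K" "distinct [a, b, c]" "{a, b, d} \<subseteq> K" "distinct [a, b, d]"
    "{a, b, d, c} \<subseteq> K" "distinct [a, b, d, c]"
    using assms(1,2) by auto
  have ne': "inside (tri a b d) \<inter> inside (tri a b c) \<noteq> {}"
    using ne by blast
  have "inside (tri a b c) \<inter> frontier (inside (tri a b d)) = {}"
    unfolding Jordan(8)[OF K(3,4)] by (rule inside_disjoint_tri[OF assms(1-3)])
  then have "inside (tri a b c) \<subseteq> inside (tri a b d)"
    by (rule connected_subset_frontier_disjoint[OF Jordan(3)[OF K(1,2)] ne])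
  moreover have "inside (tri a b d) \<inter> frontier (inside (tri a b c)) = {}"
    unfolding Jordan(8)[OF K(1,2)] by (rule inside_disjoint_tri[OF K(5,6) assms(4)])
  then have "inside (tri a b d) \<subseteq> inside (tri a b c)"
    by (rule connected_subset_frontier_disjoint[OF Jordan(3)[OF K(3,4)] ne'])
  ultimately have "inside (tri a b c) = inside (tri a b d)"
    by (rule subset_antisym)
  then have "tri a b c = tri a b d"
    using Jordan(8)[OF K(1,2)] Jordan(8)[OF K(3,4)] by metis
  moreover have "p c \<in> tri a b c" "p c \<notin> tri a b d"
    using assms(1,2) vertex_in_tri[OF K(1,2), of c] vertex_in_tri[OF K(3,4), of c] by auto
  ultimately show False
    by simp
qed

text \<open>Otherwise the inside of \<open>tri a b c\<close> is disjoint from all edges and from the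
  insides of the other three triangles, although \<open>inside_another_triangle\<close> puts each of
  its points into one of these.\<close>

lemma some_vertex_inside:
  assumes "{a, b, c, d} \<subseteq> K" "distinct [a, b, c, d]"
  shows "p d \<in> inside (tri a b c) \<or> p c \<in> inside (tri a b d) \<or>
    p a \<in> inside (tri b c d) \<or> p b \<in> inside (tri c a d)"
proof (rule ccontr)
  assume none: "\<not> ?thesis"
  obtain q where q: "q \<in> inside (tri a b c)"
    using Jordan(1)[of a b c] assms by auto
  \<comment> \<open>The disjointness lemmas speak of the shared edge \<open>a b\<close>; rotation
    makes them available for \<open>b c\<close> and \<open>c a\<close>.\<close>
  have eqs: "tri b c a = tri a b c" "tri c a b = tri a b c"
    using tri_rotate by metis+
  have dis: "inside (tri a b c) \<inter> tri a b d = {}" "inside (tri a b c) \<inter> tri b c d = {}"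
    "inside (tri a b c) \<inter> tri c a d = {}"
    using inside_disjoint_tri[of a b c d] inside_disjoint_tri[of b c a d]
      inside_disjoint_tri[of c a b d] none assms by (auto simp: eqs)
  moreover have "q \<notin> tri a b c"
    using inside_no_overlap[of "tri a b c"] q by blast
  ultimately have "q \<notin> side a b \<union> side b c \<union> side c a \<union> side a d \<union> side b d \<union> side c d"
    using q unfolding tri_def by (auto simp: side_commute)
  then have "q \<in> inside (tri a b d) \<or> q \<in> inside (tri b c d) \<or> q \<in> inside (tri c a d)"
    using inside_another_triangle[OF assms] q by blast
  moreover have "inside (tri a b c) \<inter> inside (tri a b d) = {}"
    "inside (tri a b c) \<inter> inside (tri b c d) = {}" "inside (tri a b c) \<inter> inside (tri c a d) = {}"
    using insides_disjoint[of a b c d] insides_disjoint[of b c a d] insides_disjoint[of c a b d]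
      none assms by (auto simp: eqs)
  ultimately show False
    using q by blast
qed

text \<open>The corner \<open>c\<close> is a limit of points outside \<open>tri a b c\<close>, and
  none of these can be inside \<open>tri a b d\<close>, which lies in the closed disc bounded by
  \<open>tri a b c\<close>.\<close>

lemma not_mutually_inside:
  assumes "{a, b, c, d} \<subseteq> K" "distinct [a, b, c, d]" "p d \<in> inside (tri a b c)"
  shows "p c \<notin> inside (tri a b d)"
proof
  assume c: "p c \<in> inside (tri a b d)"
  have "side a d - {p a} \<subseteq> inside (tri a b c)" "side b d - {p b} \<subseteq> inside (tri a b c)"
    using half_open_side[OF assms(1,2) _ _ assms(3)] by auto
  moreover have "p a \<in> tri a b c" "p b \<in> tri a b c" "side a b \<subseteq> tri a b c"
    using assms(1,2) by (auto simp: tri_def vertex_in_side)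
  ultimately have "tri a b d \<subseteq> inside (tri a b c) \<union> tri a b c"
    unfolding tri_def[of a b d] side_commute[of d] by blast
  then have dis: "outside (tri a b c) \<inter> tri a b d = {}"
    using inside_Int_outside[of "tri a b c"] outside_no_overlap[of "tri a b c"] by blast
  \<comment> \<open>A connected set that avoids \<open>tri a b d\<close> and meets its inside is
    contained in it; unboundedness excludes this for the outside of
    \<open>tri a b c\<close>.\<close>
  have "\<not> outside (tri a b c) \<subseteq> inside (tri a b d)"
    using Jordan(6,7) assms(1,2) bounded_subset by (metis distinct_length_2_or_more insert_subset)
  then have "outside (tri a b c) \<inter> inside (tri a b d) = {}"
    using connected_subset_frontier_disjoint[of "outside (tri a b c)" "inside (tri a b d)"]
      dis assms(1,2) by (auto simp: Jordan)
  then have "closure (outside (tri a b c)) \<inter> inside (tri a b d) = {}"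
    using Jordan(2)[of a b d] assms(1,2) open_Int_closure_eq_empty
    by (metis (no_types, opaque_lifting) distinct_length_2_or_more inf_commute insert_subset)
  moreover have "p c \<in> closure (outside (tri a b c))"
    using Jordan(9)[of a b c] vertex_in_tri[of a b c c] assms(1,2) by (auto simp: frontier_def)
  ultimately show False
    using c by blast
qed

text \<open>Being inside spreads along edges that avoid a triangle: from \<open>d\<close> to
  \<open>e\<close>, and from \<open>e\<close> on to a corner of \<open>tri a b c\<close>. That
  corner and \<open>d\<close> would then be mutually inside.\<close>

lemma fifth_vertex_outside:
  assumes "{a, b, c, d, e} \<subseteq> K" "distinct [a, b, c, d, e]"
  shows "p d \<notin> inside (tri a b c)"
proof
  assume d: "p d \<in> inside (tri a b c)"
  have eqs: "tri b c a = tri a b c" "tri c a b = tri a b c"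
    using tri_rotate by metis+
  have "p e \<in> inside (tri a b c)"
    using same_side[of a b c d e] assms d by auto
  moreover have "p e \<notin> side a b \<union> side b c \<union> side c a \<union> side a d \<union> side b d \<union> side c d"
    using assms by (auto simp: vertex_in_side)
  ultimately have "p e \<in> inside (tri a b d) \<or> p e \<in> inside (tri b c d) \<or> p e \<in> inside (tri c a d)"
    using inside_another_triangle[of a b c d "p e"] assms by auto
  then have "p c \<in> inside (tri a b d) \<or> p a \<in> inside (tri b c d) \<or> p b \<in> inside (tri c a d)"
    using same_side[of a b d e c] same_side[of b c d e a] same_side[of c a d e b] assms by auto
  then show False
    using not_mutually_inside[of a b c d] not_mutually_inside[of b c a d]
      not_mutually_inside[of c a b d] assms d by (auto simp: eqs)
qed

lemma no_five_vertices: "\<not> ({a, b, c, d, e} \<subseteq> K \<and> distinct [a, b, c, d, e])"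
  using some_vertex_inside[of a b c d] fifth_vertex_outside[of a b c d e]
    fifth_vertex_outside[of a b d c e] fifth_vertex_outside[of b c d a e]
    fifth_vertex_outside[of c a d b e]
  by auto

end

theorem planar_imp_no_K5:
  assumes "planar G" "K \<subseteq> fst G" "finite K"
    and "\<And>x y. \<lbrakk>x \<in> K; y \<in> K; x \<noteq> y\<rbrakk> \<Longrightarrow> {x, y} \<in> snd G"
  shows "card K \<le> 4"
proof (rule ccontr)
  assume "\<not> card K \<le> 4"
  \<comment> \<open>The successor form of 5 lets \<open>length_Suc_conv\<close> unfold a list of
    this length into five named vertices.\<close>
  then have "Suc (Suc (Suc (Suc (Suc 0)))) \<le> card K"
    by simp
  then obtain A where A: "A \<subseteq> K" "card A = Suc (Suc (Suc (Suc (Suc 0))))" "finite A"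
    by (rule obtain_subset_with_card_n)
  then obtain xs where xs: "set xs = A" "distinct xs" "length xs = Suc (Suc (Suc (Suc (Suc 0))))"
    by (metis finite_distinct_list distinct_card)
  then obtain a b c d e where "xs = [a, b, c, d, e]"
    by (auto simp: length_Suc_conv)
  then have K: "{a, b, c, d, e} \<subseteq> K" "distinct [a, b, c, d, e]"
    using A(1) xs(1,2) by auto
  obtain p \<gamma> where draw: "plane_drawing G p \<gamma>"
    using assms(1) by (auto simp: planar_def)
  interpret drawn_clique K p \<gamma>
  proof
    show "inj_on p K"
      using draw assms(2) by (auto simp: plane_drawing_def intro: inj_on_subset)
  next
    fix x y assume xy: "x \<in> K" "y \<in> K" "x \<noteq> y"
    note e = draw[unfolded plane_drawing_def, THEN conjunct2, THEN conjunct1, rule_format,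
        OF assms(4)[OF xy]]
    show "arc (\<gamma> {x, y})" "{pathstart (\<gamma> {x, y}), pathfinish (\<gamma> {x, y})} = {p x, p y}"
      "path_image (\<gamma> {x, y}) \<inter> p ` K \<subseteq> {p x, p y}"
      using e assms(2) by auto
    fix u v assume uv: "u \<in> K" "v \<in> K" "u \<noteq> v" "{x, y} \<noteq> {u, v}"
    show "path_image (\<gamma> {x, y}) \<inter> path_image (\<gamma> {u, v}) \<subseteq> p ` ({x, y} \<inter> {u, v})"
      using draw[unfolded plane_drawing_def, THEN conjunct2, THEN conjunct2, rule_format,
          OF assms(4)[OF xy] assms(4)[OF uv(1-3)] uv(4)] .
  qed
  show False
    using no_five_vertices K by blast
qed

section \<open>Straight-line drawings\<close>

text \<open>A drawing of \<open>G'\<close> is pulled back along an injective map that sends edges to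
  edges; this covers both subgraphs and isomorphic copies.\<close>

lemma planar_embed:
  assumes "planar G'" "inj_on \<phi> (fst G)" "\<phi> ` fst G \<subseteq> fst G'"
    and sub: "\<And>e. e \<in> snd G \<Longrightarrow> e \<subseteq> fst G \<and> \<phi> ` e \<in> snd G'"
  shows "planar G"
proof -
  obtain p \<gamma> where draw: "plane_drawing G' p \<gamma>"
    using assms(1) by (auto simp: planar_def)
  have "plane_drawing G (p \<circ> \<phi>) (\<lambda>e. \<gamma> (\<phi> ` e))"
    unfolding plane_drawing_def
  proof (intro conjI ballI impI)
    show "inj_on (p \<circ> \<phi>) (fst G)"
      using draw assms(2,3) unfolding plane_drawing_def by (blast intro: comp_inj_on inj_on_subset)
  next
    fix e assume e: "e \<in> snd G"
    note d = draw[unfolded plane_drawing_def, THEN conjunct2, THEN conjunct1, rule_format,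
        of "\<phi> ` e"]
    show "arc (\<gamma> (\<phi> ` e))" "{pathstart (\<gamma> (\<phi> ` e)), pathfinish (\<gamma> (\<phi> ` e))} = (p \<circ> \<phi>) ` e"
      using d sub[OF e] by (simp_all add: image_comp)
    have "path_image (\<gamma> (\<phi> ` e)) \<inter> p ` fst G' \<subseteq> p ` \<phi> ` e"
      using d sub[OF e] by simp
    then show "path_image (\<gamma> (\<phi> ` e)) \<inter> (p \<circ> \<phi>) ` fst G \<subseteq> (p \<circ> \<phi>) ` e"
      using assms(3) by (force simp: image_comp[symmetric])
    fix f assume f: "f \<in> snd G" "e \<noteq> f"
    \<comment> \<open>Injectivity keeps different edges different and is compatible with their
      intersections.\<close>
    have "\<phi> ` e \<noteq> \<phi> ` f" "\<phi> ` (e \<inter> f) = \<phi> ` e \<inter> \<phi> ` f"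
      using f sub e assms(2) by (simp_all add: inj_on_image_eq_iff inj_on_image_Int)
    then show "path_image (\<gamma> (\<phi> ` e)) \<inter> path_image (\<gamma> (\<phi> ` f)) \<subseteq> (p \<circ> \<phi>) ` (e \<inter> f)"
      using draw sub[OF e] sub[OF f(1)] unfolding plane_drawing_def image_comp[symmetric] by metis
  qed
  then show ?thesis
    by (auto simp: planar_def)
qed

section \<open>Orientation determinants and intersections of segments\<close>

definition cross :: "int \<times> int \<Rightarrow> int \<times> int \<Rightarrow> int \<times> int \<Rightarrow> int"
  where "cross a b c = (fst b - fst a) * (snd c - snd a) - (snd b - snd a) * (fst c - fst a)"

definition point :: "int \<times> int \<Rightarrow> complex"
  where "point a = Complex (of_int (fst a)) (of_int (snd a))"

text \<open>Twice the signed area of the triangle \<open>u v w\<close>, the real counterpart of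
  \<open>cross\<close>, whose integer values can be found by evaluation.\<close>

definition signed_area :: "complex \<Rightarrow> complex \<Rightarrow> complex \<Rightarrow> real"
  where "signed_area u v w = Re (v - u) * Im (w - u) - Im (v - u) * Re (w - u)"

lemma signed_area_point: "signed_area (point a) (point b) (point c) = of_int (cross a b c)"
  by (simp add: signed_area_def point_def cross_def)

text \<open>The determinant is affine in its third argument; one parameter \<open>t\<close> serves
  every \<open>u\<close> and \<open>v\<close>.\<close>

lemma signed_area_segment:
  assumes "w \<in> closed_segment a b"
  obtains t where "0 \<le> t" "t \<le> 1" "w = (1 - t) *\<^sub>R a + t *\<^sub>R b"
    "\<And>u v. signed_area u v w = (1 - t) * signed_area u v a + t * signed_area u v b"
proof -
  obtain t where t: "0 \<le> t" "t \<le> 1" "w = (1 - t) *\<^sub>R a + t *\<^sub>R b"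
    using assms by (auto simp: closed_segment_def)
  moreover have "signed_area u v w = (1 - t) * signed_area u v a + t * signed_area u v b" for u v
    unfolding t(3) by (simp add: signed_area_def algebra_simps)
  ultimately show thesis
    by (rule that)
qed

lemma signed_area_endpoints [simp]: "signed_area u v u = 0" "signed_area u v v = 0"
  by (simp_all add: signed_area_def)

lemma signed_area_collinear: "w \<in> closed_segment a b \<Longrightarrow> signed_area a b w = 0"
  by (erule signed_area_segment) simp

text \<open>The hypothesis puts \<open>c\<close> and \<open>d\<close> strictly on the same side of
  the line through \<open>a\<close> and \<open>b\<close>, so the segment between them misses that
  line.\<close>

lemma segments_disjoint:
  assumes "cross a b c * cross a b d > 0"
  shows "closed_segment (point a) (point b) \<inter> closed_segment (point c) (point d) = {}"
proof -
  let ?A = "signed_area (point a) (point b)"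
  have False
    if ab: "w \<in> closed_segment (point a) (point b)" and cd: "w \<in> closed_segment (point c) (point d)" for w
  proof -
    obtain t where t: "0 \<le> t" "t \<le> 1" "?A w = (1 - t) * ?A (point c) + t * ?A (point d)"
      using signed_area_segment[OF cd] by metis
    have "of_int (cross a b c * cross a b d) > (0::real)"
      using assms by (simp only: of_int_0_less_iff)
    then have "?A (point c) * ?A (point d) > 0"
      by (simp add: signed_area_point)
    \<comment> \<open>A convex combination of two numbers of the same strict sign has that sign;
      changing signs reduces the positive case to the negative one.\<close>
    then have "(1 - t) * ?A (point c) + t * ?A (point d) \<noteq> 0"
      using t(1,2) convex_bound_lt[of "?A (point c)" 0 "?A (point d)" "1 - t" t]
        convex_bound_lt[of "- ?A (point c)" 0 "- ?A (point d)" "1 - t" t]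
      by (auto simp: zero_less_mult_iff)
    then show False
      using t(3) signed_area_collinear[OF ab] by simp
  qed
  then show ?thesis
    by blast
qed

text \<open>The determinant relative to the line \<open>a b\<close> vanishes on the first segment;
  on the second it is \<open>t\<close> times its nonzero value at \<open>c\<close>, so
  \<open>t = 0\<close> at a common point.\<close>

lemma segments_share_endpoint:
  assumes "cross a b c \<noteq> 0"
  shows "closed_segment (point a) (point b) \<inter> closed_segment (point a) (point c) = {point a}"
proof -
  let ?A = "signed_area (point a) (point b)"
  have "w = point a"
    if ab: "w \<in> closed_segment (point a) (point b)" and ac: "w \<in> closed_segment (point a) (point c)" for w
  proof -
    obtain t where t: "w = (1 - t) *\<^sub>R point a + t *\<^sub>R point c"
        "?A w = (1 - t) * ?A (point a) + t * ?A (point c)"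
      using signed_area_segment[OF ac] by metis
    then have "t * of_int (cross a b c) = 0"
      using signed_area_collinear[OF ab] by (simp add: signed_area_point)
    then show ?thesis
      using t(1) assms by simp
  qed
  then show ?thesis
    by auto
qed

text \<open>General position keeps vertices off foreign edges and lets edges with a common vertex
  meet only there. For vertex-disjoint edges it is enough that one of them lies strictly on one side
  of the line through the other.\<close>

lemma straight_line_planar:
  fixes q :: "nat \<Rightarrow> int \<times> int"
  assumes edges: "\<And>i j. (i, j) \<in> S \<Longrightarrow> i < j \<and> j < n"
    and general: "\<And>i j k. \<lbrakk>i < j; j < k; k < n\<rbrakk> \<Longrightarrow> cross (q i) (q j) (q k) \<noteq> 0"
    and inj: "inj_on q {..<n}"
    and crossing: "\<And>i j k l. \<lbrakk>(i, j) \<in> S; (k, l) \<in> S; distinct [i, j, k, l]\<rbrakk> \<Longrightarrow>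
      cross (q i) (q j) (q k) * cross (q i) (q j) (q l) > 0 \<or>
      cross (q k) (q l) (q i) * cross (q k) (q l) (q j) > 0"
  shows "planar ({..<n}, (\<lambda>(i, j). {i, j}) ` S)"
proof -
  define P where "P = point \<circ> q"
  \<comment> \<open>An edge is an unordered set, so its smaller index is taken as the start of the
    segment.\<close>
  define \<gamma> where "\<gamma> e = linepath (P (Min e)) (P (Max e))" for e
  have \<gamma>: "\<gamma> {i, j} = linepath (P i) (P j)" if "(i, j) \<in> S" for i j
    using edges[OF that] by (simp add: \<gamma>_def)
  have injP: "inj_on P {..<n}"
    using inj by (auto simp: P_def inj_on_def point_def prod_eq_iff)
  have cross_perm: "cross b a c = - cross a b c" "cross a c b = - cross a b c" for a b c
    by (simp_all add: cross_def algebra_simps)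
  \<comment> \<open>The determinant changes sign under transpositions, which extends the hypothesis
    from increasing triples to all triples of distinct indices.\<close>
  have general': "cross (q i) (q j) (q k) \<noteq> 0"
    if ij: "i < n" "j < n" "k < n" "i \<noteq> j" "j \<noteq> k" "i \<noteq> k" for i j k
    using general[of i j k] general[of i k j] general[of j i k] general[of j k i]
      general[of k i j] general[of k j i] cross_perm ij
    by (metis linorder_neqE_nat neg_equal_0_iff_equal)
  have share: "closed_segment (P i) (P j) \<inter> closed_segment (P i) (P k) = {P i}"
    if "i < n" "j < n" "k < n" "i \<noteq> j" "j \<noteq> k" "i \<noteq> k" for i j k
    using segments_share_endpoint[OF general'[OF that]] by (simp add: P_def)
  have arc: "arc (\<gamma> {i, j})" "{pathstart (\<gamma> {i, j}), pathfinish (\<gamma> {i, j})} = P ` {i, j}"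
    if ij: "(i, j) \<in> S" for i j
  proof -
    have "P i \<noteq> P j"
      using edges[OF ij] injP by (auto simp: inj_on_eq_iff)
    then show "arc (\<gamma> {i, j})" "{pathstart (\<gamma> {i, j}), pathfinish (\<gamma> {i, j})} = P ` {i, j}"
      by (simp_all add: \<gamma>[OF ij])
  qed
  have vertices: "path_image (\<gamma> {i, j}) \<inter> P ` {..<n} \<subseteq> P ` {i, j}" if ij: "(i, j) \<in> S" for i j
  proof
    fix w assume "w \<in> path_image (\<gamma> {i, j}) \<inter> P ` {..<n}"
    then obtain k where k: "w = P k" "P k \<in> closed_segment (P i) (P j)" "k < n"
      by (auto simp: \<gamma>[OF ij])
    have "k = i \<or> k = j"
      using signed_area_collinear[OF k(2)] general'[of i j k] edges[OF ij] k(3)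
      by (auto simp: P_def signed_area_point)
    then show "w \<in> P ` {i, j}"
      using k(1) by blast
  qed
  have meet: "path_image (\<gamma> {i, j}) \<inter> path_image (\<gamma> {k, l}) \<subseteq> P ` ({i, j} \<inter> {k, l})"
    if ij: "(i, j) \<in> S" and kl: "(k, l) \<in> S" and ne: "{i, j} \<noteq> {k, l}" for i j k l
  proof -
    note lt = edges[OF ij] edges[OF kl]
    \<comment> \<open>Different edges share at most one vertex, in one of four positions.\<close>
    consider "i = k" "j \<noteq> l" | "i = l" "j \<noteq> k" | "j = k" "i \<noteq> l" | "j = l" "i \<noteq> k" | "distinct [i, j, k, l]"
      using ne lt by auto
    then have "closed_segment (P i) (P j) \<inter> closed_segment (P k) (P l) \<subseteq> P ` ({i, j} \<inter> {k, l})"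
    proof cases
      case 1 then show ?thesis using share[of i j l] lt by auto
    next
      case 2 then show ?thesis using share[of i j k] lt by (auto simp: closed_segment_commute)
    next
      case 3 then show ?thesis using share[of j i l] lt by (auto simp: closed_segment_commute)
    next
      case 4 then show ?thesis using share[of j i k] lt by (auto simp: closed_segment_commute)
    next
      case 5
      have "closed_segment (P i) (P j) \<inter> closed_segment (P k) (P l) = {}"
        using crossing[OF ij kl 5] segments_disjoint[of "q i" "q j" "q k" "q l"]
          segments_disjoint[of "q k" "q l" "q i" "q j"] by (auto simp: P_def)
      then show ?thesis by simp
    qed
    then show ?thesis
      by (simp add: \<gamma>[OF ij] \<gamma>[OF kl])
  qed
  have "plane_drawing ({..<n}, (\<lambda>(i, j). {i, j}) ` S) P \<gamma>"
    unfolding plane_drawing_def fst_conv snd_conv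
  proof (intro conjI ballI impI)
    show "inj_on P {..<n}" by (rule injP)
  next
    fix e assume "e \<in> (\<lambda>(i, j). {i, j}) ` S"
    then obtain i j where e: "(i, j) \<in> S" "e = {i, j}"
      by auto
    show "arc (\<gamma> e)" "{pathstart (\<gamma> e), pathfinish (\<gamma> e)} = P ` e" "path_image (\<gamma> e) \<inter> P ` {..<n} \<subseteq> P ` e"
      unfolding e(2) using arc[OF e(1)] vertices[OF e(1)] by auto
    fix f assume f: "f \<in> (\<lambda>(i, j). {i, j}) ` S" "e \<noteq> f"
    then obtain k l where "(k, l) \<in> S" "f = {k, l}"
      by auto
    then show "path_image (\<gamma> e) \<inter> path_image (\<gamma> f) \<subseteq> P ` (e \<inter> f)"
      using meet[OF e(1), of k l] e(2) f(2) by simp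
  qed
  then show ?thesis
    by (auto simp: planar_def)
qed

text \<open>All conditions become quantifications over explicit lists, so that evaluation can check
  them for a concrete drawing.\<close>

lemma straight_line_planar_list:
  assumes "\<forall>(i, j)\<in>set L. i < j \<and> j < length ps"
    and "\<forall>k\<in>set [0..<length ps]. \<forall>j\<in>set [0..<k]. \<forall>i\<in>set [0..<j]. cross (ps ! i) (ps ! j) (ps ! k) \<noteq> 0"
    and "distinct ps"
    and "\<forall>(i, j)\<in>set L. \<forall>(k, l)\<in>set L. distinct [i, j, k, l] \<longrightarrow>
      cross (ps ! i) (ps ! j) (ps ! k) * cross (ps ! i) (ps ! j) (ps ! l) > 0 \<or>
      cross (ps ! k) (ps ! l) (ps ! i) * cross (ps ! k) (ps ! l) (ps ! j) > 0"
  shows "planar ({..<length ps}, (\<lambda>(i, j). {i, j}) ` set L)"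
  using assms by (intro straight_line_planar[where q = "(!) ps"])
    (auto simp: inj_on_nth simp del: distinct.simps)

text \<open>Two complete graphs, on \<open>0, 1, 2, 3\<close> and on \<open>0, 4, 5, 6\<close>,
  glued at the vertex \<open>0\<close>.\<close>

definition bow_tie :: "(nat \<times> nat) list"
  where "bow_tie = [(0, 1), (0, 2), (0, 3), (1, 2), (1, 3), (2, 3),
    (0, 4), (0, 5), (0, 6), (4, 5), (4, 6), (5, 6)]"

lemma planar_bow_tie: "planar ({..<7}, (\<lambda>(i, j). {i, j}) ` set bow_tie)"
proof -
  \<comment> \<open>The two complete graphs lie in opposite half planes and meet at the origin. In
    each of them one vertex, \<open>2\<close> or \<open>5\<close>, is inside the triangle of the
    other three.\<close>
  let ?ps = "[(0, 0), (2, 0), (1, 1), (1, 2), (-2, -1), (-1, 1), (-1, 2)] :: (int \<times> int) list"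
  have "planar ({..<length ?ps}, (\<lambda>(i, j). {i, j}) ` set bow_tie)"
    by (rule straight_line_planar_list) code_simp+
  then show ?thesis
    by (simp add: numeral_eq_Suc)
qed

text \<open>Two numbers below 7 are joined if they have a common binary digit 0 among their last three.\<close>

definition common_zero_digit :: "(nat \<times> nat) list"
  where "common_zero_digit = [(0, 1), (0, 2), (0, 3), (0, 4), (0, 5), (0, 6), (1, 2), (1, 3),
    (1, 4), (1, 5), (2, 3), (2, 4), (2, 6), (4, 5), (4, 6)]"

lemma planar_common_zero_digit: "planar ({..<7}, (\<lambda>(i, j). {i, j}) ` set common_zero_digit)"
proof -
  \<comment> \<open>The vertex \<open>0\<close> is the centroid of the triangle with corners
    \<open>1\<close>, \<open>2\<close>, \<open>4\<close>; the vertices \<open>3\<close>,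
    \<open>5\<close>, \<open>6\<close> lie in the three smaller triangles that it forms with the
    sides.\<close>
  let ?ps = "[(0, 0), (1, -2), (-3, -1), (-1, -1), (2, 3), (1, 0), (0, 1)] :: (int \<times> int) list"
  have "planar ({..<length ?ps}, (\<lambda>(i, j). {i, j}) ` set common_zero_digit)"
    by (rule straight_line_planar_list) code_simp+
  then show ?thesis
    by (simp add: numeral_eq_Suc)
qed

section \<open>Embedding unions of small cliques into the two model graphs\<close>

lemma bow_tie_edge:
  assumes "a \<noteq> b" "{a, b} \<subseteq> {0, 1, 2, 3} \<or> {a, b} \<subseteq> {0, 4, 5, 6}"
  shows "{a, b} \<in> (\<lambda>(i, j). {i, j}) ` set bow_tie"
proof -
  have "(a, b) \<in> set bow_tie \<or> (b, a) \<in> set bow_tie"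
    using assms unfolding bow_tie_def insert_subset by (elim disjE conjE insertE emptyE; simp)
  then show ?thesis
    by (auto simp: image_iff insert_commute)
qed

lemma common_zero_digit_edge:
  assumes "a \<noteq> b"
    "{a, b} \<subseteq> {0, 1, 2, 3} \<or> {a, b} \<subseteq> {0, 1, 4, 5} \<or> {a, b} \<subseteq> {0, 2, 4, 6}"
  shows "{a, b} \<in> (\<lambda>(i, j). {i, j}) ` set common_zero_digit"
proof -
  have "(a, b) \<in> set common_zero_digit \<or> (b, a) \<in> set common_zero_digit"
    using assms unfolding common_zero_digit_def insert_subset by (elim disjE conjE insertE emptyE; simp)
  then show ?thesis
    by (auto simp: image_iff insert_commute)
qed

text \<open>Sending \<open>z\<close> to \<open>0\<close> and the remaining vertices, at most three
  in either set, to \<open>1, 2, 3\<close> and \<open>4, 5, 6\<close> embeds the graph into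
  \<open>bow_tie\<close>.\<close>

lemma planar_two_cliques_sharing_vertex:
  assumes "finite A" "finite B" "card A \<le> 4" "card B \<le> 4" "A \<inter> B = {z}"
    and edges: "\<And>e. e \<in> E \<Longrightarrow> \<exists>x y. e = {x, y} \<and> x \<noteq> y \<and> ({x, y} \<subseteq> A \<or> {x, y} \<subseteq> B)"
  shows "planar (A \<union> B, E)"
proof -
  have "z \<in> A" "z \<in> B"
    using assms(5) by auto
  then have "card (A - {z}) \<le> card {1, 2, 3::nat}" "card (B - {z}) \<le> card {4, 5, 6::nat}"
    using assms(3,4) by simp_all
  then obtain f g where f: "inj_on f (A - {z})" "f ` (A - {z}) \<subseteq> {1, 2, 3::nat}"
    and g: "inj_on g (B - {z})" "g ` (B - {z}) \<subseteq> {4, 5, 6::nat}"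
    using card_le_inj[of "A - {z}" "{1, 2, 3::nat}"] card_le_inj[of "B - {z}" "{4, 5, 6::nat}"] assms(1,2)
    by auto
  define \<phi> where "\<phi> v = (if v = z then 0 else if v \<in> A then f v else g v)" for v
  have A: "\<phi> v \<in> {0, 1, 2, 3}" if "v \<in> A" for v
    using that f by (auto simp: \<phi>_def)
  have B: "\<phi> v \<in> {0, 4, 5, 6}" if "v \<in> B" for v
    using that g assms(5) by (auto simp: \<phi>_def)
  have small: "0 < \<phi> v \<and> \<phi> v < 4" "\<phi> v = f v" if v: "v \<in> A" "v \<noteq> z" for v
  proof -
    have "f v \<in> {1, 2, 3}"
      using v f(2) by blast
    then show "0 < \<phi> v \<and> \<phi> v < 4" "\<phi> v = f v"
      using v by (auto simp: \<phi>_def)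
  qed
  have large: "3 < \<phi> v" "\<phi> v = g v" if v: "v \<in> B" "v \<noteq> z" for v
  proof -
    have "g v \<in> {4, 5, 6}"
      using v g(2) by blast
    moreover have "v \<notin> A"
      using v assms(5) by blast
    ultimately show "3 < \<phi> v" "\<phi> v = g v"
      using v by (auto simp: \<phi>_def)
  qed
  have "\<phi> z = 0"
    by (simp add: \<phi>_def)
  have nonzero: "\<phi> v \<noteq> 0" if "v \<in> A \<union> B" "v \<noteq> z" for v
    using that small(1)[of v] large(1)[of v] by auto
  have inj: "inj_on \<phi> (A \<union> B)"
  proof (rule inj_onI)
    fix u v assume uv: "u \<in> A \<union> B" "v \<in> A \<union> B" "\<phi> u = \<phi> v"
    show "u = v"
    proof (cases "u = z \<or> v = z")
      case True
      then show ?thesis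
        using uv nonzero \<open>\<phi> z = 0\<close> by metis
    next
      case False
      then consider "u \<in> A" "v \<in> A" | "u \<in> B" "v \<in> B" | "u \<in> A" "v \<in> B" | "u \<in> B" "v \<in> A"
        using uv(1,2) by blast
      then show ?thesis
      proof cases
        case 1
        then have "f u = f v"
          using uv(3) small(2)[of u] small(2)[of v] False by simp
        then show ?thesis
          using inj_onD[OF f(1)] 1 False by blast
      next
        case 2
        then have "g u = g v"
          using uv(3) large(2)[of u] large(2)[of v] False by simp
        then show ?thesis
          using inj_onD[OF g(1)] 2 False by blast
      next
        case 3
        then show ?thesis
          using uv(3) small(1)[of u] large(1)[of v] False by simp
      next
        case 4
        then show ?thesis
          using uv(3) small(1)[of v] large(1)[of u] False by simp
      qed
    qed
  qed
  show ?thesis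
  proof (rule planar_embed[OF planar_bow_tie, of \<phi>])
    show "inj_on \<phi> (fst (A \<union> B, E))"
      using inj by simp
    show "\<phi> ` fst (A \<union> B, E) \<subseteq> fst ({..<7}, (\<lambda>(i, j). {i, j}) ` set bow_tie)"
      unfolding fst_conv
    proof (rule image_subsetI)
      fix v assume "v \<in> A \<union> B"
      then show "\<phi> v \<in> {..<7}"
        using A[of v] B[of v] by auto
    qed
    fix e assume "e \<in> snd (A \<union> B, E)"
    then have "e \<in> E"
      by simp
    from edges[OF this] obtain x y where e: "e = {x, y}" "x \<noteq> y" "{x, y} \<subseteq> A \<or> {x, y} \<subseteq> B"
      by blast
    have "x \<in> A \<union> B" "y \<in> A \<union> B"
      using e(3) by auto
    then have "\<phi> x \<noteq> \<phi> y"
      using inj_on_eq_iff[OF inj] e(2) by simp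
    moreover have "{\<phi> x, \<phi> y} \<subseteq> {0, 1, 2, 3} \<or> {\<phi> x, \<phi> y} \<subseteq> {0, 4, 5, 6}"
      using e(3)
    proof
      assume "{x, y} \<subseteq> A"
      then have "\<phi> x \<in> {0, 1, 2, 3}" "\<phi> y \<in> {0, 1, 2, 3}"
        using A by simp_all
      then show ?thesis
        by (intro disjI1) simp
    next
      assume "{x, y} \<subseteq> B"
      then have "\<phi> x \<in> {0, 4, 5, 6}" "\<phi> y \<in> {0, 4, 5, 6}"
        using B by simp_all
      then show ?thesis
        by (intro disjI2) simp
    qed
    ultimately have "{\<phi> x, \<phi> y} \<in> (\<lambda>(i, j). {i, j}) ` set bow_tie"
      by (rule bow_tie_edge)
    then show "e \<subseteq> fst (A \<union> B, E) \<and> \<phi> ` e \<in> snd ({..<7}, (\<lambda>(i, j). {i, j}) ` set bow_tie)"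
      unfolding e(1) using e(3) by auto
  qed
qed

lemma planar_common_zero_digit_embed:
  fixes \<phi> :: "'a \<Rightarrow> nat"
  assumes "inj_on \<phi> V" "\<phi> ` V \<subseteq> {..<7}"
    and edges: "\<And>e. e \<in> E \<Longrightarrow> \<exists>x y. e = {x, y} \<and> x \<noteq> y \<and> {x, y} \<subseteq> V \<and>
      ({\<phi> x, \<phi> y} \<subseteq> {0, 1, 2, 3} \<or> {\<phi> x, \<phi> y} \<subseteq> {0, 1, 4, 5} \<or> {\<phi> x, \<phi> y} \<subseteq> {0, 2, 4, 6})"
  shows "planar (V, E)"
proof (rule planar_embed[OF planar_common_zero_digit, of \<phi>])
  show "inj_on \<phi> (fst (V, E))" "\<phi> ` fst (V, E) \<subseteq> fst ({..<7}, (\<lambda>(i, j). {i, j}) ` set common_zero_digit)"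
    using assms(1,2) by auto
  fix e assume "e \<in> snd (V, E)"
  then have "e \<in> E"
    by simp
  from edges[OF this] obtain x y where e: "e = {x, y}" "x \<noteq> y" "{x, y} \<subseteq> V"
    "{\<phi> x, \<phi> y} \<subseteq> {0, 1, 2, 3} \<or> {\<phi> x, \<phi> y} \<subseteq> {0, 1, 4, 5} \<or> {\<phi> x, \<phi> y} \<subseteq> {0, 2, 4, 6}"
    by blast
  have "\<phi> x \<noteq> \<phi> y"
    using inj_on_eq_iff[OF assms(1), of x y] e(2,3) by simp
  then have "{\<phi> x, \<phi> y} \<in> (\<lambda>(i, j). {i, j}) ` set common_zero_digit"
    using e(4) by (rule common_zero_digit_edge)
  then show "e \<subseteq> fst (V, E) \<and> \<phi> ` e \<in> snd ({..<7}, (\<lambda>(i, j). {i, j}) ` set common_zero_digit)"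
    unfolding e(1) using e(3) by simp
qed

text \<open>The cliques \<open>0, 1, 2, 3\<close> and \<open>0, 1, 4, 5\<close> of
  \<open>common_zero_digit\<close> share the edge between \<open>0\<close> and \<open>1\<close>,
  which receives \<open>z\<close> and \<open>t\<close>.\<close>

lemma planar_two_cliques_sharing_edge:
  assumes "distinct [z, t, u, v, u', v']"
    and edges: "\<And>e. e \<in> E \<Longrightarrow> \<exists>x y. e = {x, y} \<and> x \<noteq> y \<and> ({x, y} \<subseteq> {z, t, u, v} \<or> {x, y} \<subseteq> {z, t, u', v'})"
  shows "planar ({z, t, u, v, u', v'}, E)"
proof -
  \<comment> \<open>The default value 5 is the number of \<open>v'\<close>.\<close>
  define \<phi> where "\<phi> = (\<lambda>_. 5)(z := 0, t := 1, u := 2, v := 3, u' := 4 :: nat)"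
  have \<phi>: "\<phi> z = 0" "\<phi> t = 1" "\<phi> u = 2" "\<phi> v = 3" "\<phi> u' = 4" "\<phi> v' = 5"
    using assms(1) by (auto simp: \<phi>_def)
  show ?thesis
  proof (rule planar_common_zero_digit_embed)
    show "inj_on \<phi> {z, t, u, v, u', v'}" "\<phi> ` {z, t, u, v, u', v'} \<subseteq> {..<7}"
      using assms(1) by (auto simp: \<phi>)
    fix e assume "e \<in> E"
    from edges[OF this] obtain x y where e: "e = {x, y}" "x \<noteq> y"
      and sub: "{x, y} \<subseteq> {z, t, u, v} \<or> {x, y} \<subseteq> {z, t, u', v'}"
      by blast
    have "{\<phi> x, \<phi> y} \<subseteq> {0, 1, 2, 3}" if "{x, y} \<subseteq> {z, t, u, v}"
      using image_mono[OF that, of \<phi>] by (simp add: \<phi>)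
    moreover have "{\<phi> x, \<phi> y} \<subseteq> {0, 1, 4, 5}" if "{x, y} \<subseteq> {z, t, u', v'}"
      using image_mono[OF that, of \<phi>] by (simp add: \<phi>)
    moreover have "{x, y} \<subseteq> {z, t, u, v, u', v'}"
      using sub by (elim disjE subset_trans) simp_all
    ultimately have "e = {x, y} \<and> x \<noteq> y \<and> {x, y} \<subseteq> {z, t, u, v, u', v'} \<and>
        ({\<phi> x, \<phi> y} \<subseteq> {0, 1, 2, 3} \<or> {\<phi> x, \<phi> y} \<subseteq> {0, 1, 4, 5} \<or> {\<phi> x, \<phi> y} \<subseteq> {0, 2, 4, 6})"
      using e sub by metis
    then show "\<exists>x y. e = {x, y} \<and> x \<noteq> y \<and> {x, y} \<subseteq> {z, t, u, v, u', v'} \<and>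
        ({\<phi> x, \<phi> y} \<subseteq> {0, 1, 2, 3} \<or> {\<phi> x, \<phi> y} \<subseteq> {0, 1, 4, 5} \<or> {\<phi> x, \<phi> y} \<subseteq> {0, 2, 4, 6})"
      by (intro exI)
  qed
qed

section \<open>Adjacency, idempotents and products\<close>

lemma (in cring) mult_nonunit:
  assumes "z \<in> nonunits R" "r \<in> carrier R"
  shows "r \<otimes> z \<in> nonunits R"
  using assms unit_factor[of z r] m_comm[of r z] by (auto simp: nonunits_def)

lemma (in cring) genideal_subset_iff:
  assumes "x \<in> carrier R" "z \<in> carrier R"
  shows "Idl {x} \<subseteq> Idl {z} \<longleftrightarrow> x \<in> PIdl z"
  using assms cgenideal_eq_genideal cgenideal_self cgenideal_minimal[OF cgenideal_ideal]
  by (metis subset_eq)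

lemma (in cring) cgenideal_nonunit:
  assumes "z \<in> nonunits R"
  shows "PIdl z \<subseteq> nonunits R"
  using assms mult_nonunit by (auto simp: cgenideal_def)

text \<open>Multiples of a nonunit are nonunits, so membership in \<open>PIdl z\<close> already
  makes \<open>x\<close> and \<open>y\<close> vertices. Adjacency thus means lying in a common
  proper principal ideal.\<close>

lemma (in cring) edge_iff:
  "e \<in> snd (upper_ideal_relation_graph R) \<longleftrightarrow>
    (\<exists>x y z. e = {x, y} \<and> x \<noteq> y \<and> z \<in> nonunits R \<and> x \<in> PIdl z \<and> y \<in> PIdl z)"
proof -
  have carr: "x \<in> carrier R" if "x \<in> nonunits R" for x
    using that by (simp add: nonunits_def)
  show ?thesis
  proof
    assume "e \<in> snd (upper_ideal_relation_graph R)"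
    then obtain x y z where "e = {x, y}" "x \<in> nonunits R" "y \<in> nonunits R" "x \<noteq> y" "z \<in> nonunits R"
      "Idl {x} \<subseteq> Idl {z}" "Idl {y} \<subseteq> Idl {z}"
      unfolding upper_ideal_relation_graph_def snd_conv by blast
    moreover from this have "x \<in> PIdl z" "y \<in> PIdl z"
      using genideal_subset_iff carr by simp_all
    ultimately show "\<exists>x y z. e = {x, y} \<and> x \<noteq> y \<and> z \<in> nonunits R \<and> x \<in> PIdl z \<and> y \<in> PIdl z"
      by metis
  next
    assume "\<exists>x y z. e = {x, y} \<and> x \<noteq> y \<and> z \<in> nonunits R \<and> x \<in> PIdl z \<and> y \<in> PIdl z"
    then obtain x y z where e: "e = {x, y}" "x \<noteq> y" "z \<in> nonunits R" "x \<in> PIdl z" "y \<in> PIdl z"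
      by metis
    then have "x \<in> nonunits R" "y \<in> nonunits R"
      using cgenideal_nonunit by auto
    moreover from this have "Idl {x} \<subseteq> Idl {z}" "Idl {y} \<subseteq> Idl {z}"
      using genideal_subset_iff carr e by simp_all
    ultimately show "e \<in> snd (upper_ideal_relation_graph R)"
      unfolding upper_ideal_relation_graph_def snd_conv using e by blast
  qed
qed

lemma fst_graph [simp]: "fst (upper_ideal_relation_graph R) = nonunits R"
  by (simp add: upper_ideal_relation_graph_def)

lemma ring_iso_nonunits:
  assumes h: "h \<in> ring_iso R S" and "ring R" "ring S" and x: "x \<in> nonunits R"
  shows "h x \<in> nonunits S"
proof -
  interpret R: ring R by fact
  interpret S: ring S by fact
  note hom = ring_iso_memE[OF h]
  have "x \<in> Units R" if u: "h x \<in> Units S"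
  proof -
    obtain v where v: "v \<in> carrier S" "v \<otimes>\<^bsub>S\<^esub> h x = \<one>\<^bsub>S\<^esub>" "h x \<otimes>\<^bsub>S\<^esub> v = \<one>\<^bsub>S\<^esub>"
      using u by (auto simp: Units_def)
    obtain y where y: "y \<in> carrier R" "v = h y"
      using v(1) hom(5) by (auto simp: bij_betw_def)
    have inj: "inj_on h (carrier R)"
      using hom(5) by (simp add: bij_betw_def)
    have xc: "x \<in> carrier R"
      using x by (simp add: nonunits_def)
    have "h (y \<otimes>\<^bsub>R\<^esub> x) = h \<one>\<^bsub>R\<^esub>" "h (x \<otimes>\<^bsub>R\<^esub> y) = h \<one>\<^bsub>R\<^esub>"
      using v(2,3) y xc hom(2,4) by simp_all
    then have "y \<otimes>\<^bsub>R\<^esub> x = \<one>\<^bsub>R\<^esub>" "x \<otimes>\<^bsub>R\<^esub> y = \<one>\<^bsub>R\<^esub>"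
      using inj_onD[OF inj] xc y(1) by simp_all
    then show ?thesis
      using xc y(1) by (auto simp: Units_def)
  qed
  then show ?thesis
    using x hom(1) by (auto simp: nonunits_def)
qed

text \<open>For an idempotent \<open>e\<close> this is the ring \<open>eR\<close> with unit
  \<open>e\<close>, described as the fixed points of multiplication by \<open>e\<close>; it keeps
  the element type and the operations of \<open>R\<close>.\<close>

definition corner :: "('a, 'm) ring_scheme \<Rightarrow> 'a \<Rightarrow> 'a ring"
  where "corner R e = \<lparr>carrier = {x \<in> carrier R. e \<otimes>\<^bsub>R\<^esub> x = x}, monoid.mult = monoid.mult R, one = e,
    ring.zero = \<zero>\<^bsub>R\<^esub>, ring.add = ring.add R\<rparr>"

lemma (in cring) corner_cring:
  assumes e: "e \<in> carrier R" "e \<otimes> e = e"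
  shows "cring (corner R e)"
proof (rule cringI)
  have neg: "e \<otimes> (\<ominus> x) = \<ominus> x" if "x \<in> carrier R" "e \<otimes> x = x" for x
    using that e(1) by (simp add: r_minus)
  show "abelian_group (corner R e)"
  proof (rule abelian_groupI)
    fix x assume "x \<in> carrier (corner R e)"
    then show "\<exists>y\<in>carrier (corner R e). y \<oplus>\<^bsub>corner R e\<^esub> x = \<zero>\<^bsub>corner R e\<^esub>"
      using neg[of x] by (intro bexI[of _ "\<ominus> x"]) (auto simp: corner_def l_neg)
  qed (use e in \<open>auto simp: corner_def r_distr a_ac\<close>)
  show "comm_monoid (corner R e)"
    by (rule comm_monoidI) (use e in \<open>auto simp: corner_def m_assoc[symmetric], auto simp: m_ac\<close>)
  show "(x \<oplus>\<^bsub>corner R e\<^esub> y) \<otimes>\<^bsub>corner R e\<^esub> z = x \<otimes>\<^bsub>corner R e\<^esub> z \<oplus>\<^bsub>corner R e\<^esub> y \<otimes>\<^bsub>corner R e\<^esub> z"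
    if "x \<in> carrier (corner R e)" "y \<in> carrier (corner R e)" "z \<in> carrier (corner R e)" for x y z
    using that by (simp add: corner_def l_distr)
qed

section \<open>Direct products and splitting along an idempotent\<close>

lemma RDirProd_simps [simp]:
  "carrier (RDirProd S T) = carrier S \<times> carrier T"
  "(a, b) \<otimes>\<^bsub>RDirProd S T\<^esub> (c, d) = (a \<otimes>\<^bsub>S\<^esub> c, b \<otimes>\<^bsub>T\<^esub> d)"
  "(a, b) \<oplus>\<^bsub>RDirProd S T\<^esub> (c, d) = (a \<oplus>\<^bsub>S\<^esub> c, b \<oplus>\<^bsub>T\<^esub> d)"
  "\<one>\<^bsub>RDirProd S T\<^esub> = (\<one>\<^bsub>S\<^esub>, \<one>\<^bsub>T\<^esub>)"
  "\<zero>\<^bsub>RDirProd S T\<^esub> = (\<zero>\<^bsub>S\<^esub>, \<zero>\<^bsub>T\<^esub>)"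
  by (auto simp: RDirProd_def DirProd_def monoid.defs)

lemma RDirProd_cring:
  assumes "cring S" "cring T"
  shows "cring (RDirProd S T)"
proof -
  interpret S: cring S by fact
  interpret T: cring T by fact
  interpret ring "RDirProd S T"
    by (rule RDirProd_ring[OF S.ring_axioms T.ring_axioms])
  show ?thesis
    by unfold_locales (auto simp: S.m_comm T.m_comm)
qed

text \<open>The Peirce decomposition: \<open>x\<close> goes to \<open>e x\<close> and
  \<open>(1 - e) x\<close>. As \<open>e\<close> and \<open>1 - e\<close> are orthogonal idempotents
  with sum 1, addition is the inverse map.\<close>

lemma (in cring) idempotent_decomposition:
  assumes e: "e \<in> carrier R" "e \<otimes> e = e"
  shows "R \<simeq> RDirProd (corner R e) (corner R (\<one> \<ominus> e))"
proof -
  let ?f = "\<one> \<ominus> e"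
  let ?h = "\<lambda>x. (e \<otimes> x, ?f \<otimes> x)"
  have f: "?f \<in> carrier R" "?f \<otimes> ?f = ?f" "e \<otimes> ?f = \<zero>" "?f \<otimes> e = \<zero>"
    using e by (simp_all add: minus_eq l_distr r_distr r_minus l_minus r_neg l_neg a_ac)
  have sum: "e \<oplus> ?f = \<one>"
    using e(1) r_neg[of e] a_lcomm[of e \<one> "\<ominus> e"] by (simp add: minus_eq)
  have idem: "g \<otimes> (g \<otimes> x) = g \<otimes> x" "g \<otimes> (x \<otimes> y) = g \<otimes> x \<otimes> (g \<otimes> y)"
    if "g \<in> carrier R" "g \<otimes> g = g" "x \<in> carrier R" "y \<in> carrier R" for g x y
  proof -
    show g: "g \<otimes> (g \<otimes> x) = g \<otimes> x"
      using that by (simp add: m_assoc[symmetric])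
    have "g \<otimes> x \<otimes> (g \<otimes> y) = g \<otimes> (g \<otimes> x) \<otimes> y"
      using that(1,3,4) by (simp add: m_ac)
    then show "g \<otimes> (x \<otimes> y) = g \<otimes> x \<otimes> (g \<otimes> y)"
      using that(1,3,4) by (simp add: g m_assoc)
  qed
  have orth: "e \<otimes> (?f \<otimes> x) = \<zero>" "?f \<otimes> (e \<otimes> x) = \<zero>" if "x \<in> carrier R" for x
    using that e(1) f by (simp_all add: m_assoc[symmetric])
  have split: "e \<otimes> x \<oplus> ?f \<otimes> x = x" if "x \<in> carrier R" for x
    using that e(1) f(1) sum by (simp add: l_distr[symmetric])
  have "?h \<in> ring_iso R (RDirProd (corner R e) (corner R ?f))"
  proof (rule ring_iso_memI)
    show "bij_betw ?h (carrier R) (carrier (RDirProd (corner R e) (corner R ?f)))"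
    proof (rule bij_betw_byWitness[where f' = "\<lambda>(a, b). a \<oplus> b"])
      show "\<forall>x\<in>carrier R. (case ?h x of (a, b) \<Rightarrow> a \<oplus> b) = x"
        using split by simp
      show "\<forall>ab\<in>carrier (RDirProd (corner R e) (corner R ?f)). ?h (case ab of (a, b) \<Rightarrow> a \<oplus> b) = ab"
      proof clarsimp
        fix a b assume ab: "a \<in> carrier (corner R e)" "b \<in> carrier (corner R ?f)"
        then have "a \<in> carrier R" "e \<otimes> a = a" "b \<in> carrier R" "?f \<otimes> b = b"
          by (auto simp: corner_def)
        moreover from this have "e \<otimes> b = \<zero>" "?f \<otimes> a = \<zero>"
          using orth(1)[of b] orth(2)[of a] by simp_all
        ultimately show "e \<otimes> (a \<oplus> b) = a \<and> ?f \<otimes> (a \<oplus> b) = b"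
          using e(1) f(1) by (simp add: r_distr)
      qed
      show "?h ` carrier R \<subseteq> carrier (RDirProd (corner R e) (corner R ?f))"
        using e f idem(1) by (auto simp: corner_def)
      show "(\<lambda>(a, b). a \<oplus> b) ` carrier (RDirProd (corner R e) (corner R ?f)) \<subseteq> carrier R"
        by (auto simp: corner_def)
    qed
  next
    fix x y assume xy: "x \<in> carrier R" "y \<in> carrier R"
    show "?h x \<in> carrier (RDirProd (corner R e) (corner R ?f))"
      using xy e f idem(1) by (simp add: corner_def)
    show "?h (x \<otimes> y) = ?h x \<otimes>\<^bsub>RDirProd (corner R e) (corner R ?f)\<^esub> ?h y"
      using idem(2)[OF e xy] idem(2)[OF f(1,2) xy] by (simp add: corner_def)
    show "?h (x \<oplus> y) = ?h x \<oplus>\<^bsub>RDirProd (corner R e) (corner R ?f)\<^esub> ?h y"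
      using xy e(1) f(1) by (simp add: corner_def r_distr)
  next
    show "?h \<one> = \<one>\<^bsub>RDirProd (corner R e) (corner R ?f)\<^esub>"
      using e(1) f(1) by (simp add: corner_def)
  qed
  then show ?thesis
    by (auto simp: is_ring_iso_def)
qed

text \<open>By finiteness the powers of \<open>x\<close> are periodic from some exponent
  \<open>i\<close> on, with a period \<open>p\<close>. If \<open>n \<ge> i\<close> is a multiple of
  \<open>p\<close>, the powers with exponents \<open>n\<close> and \<open>2n\<close> agree.\<close>

lemma (in cring) finite_power_idempotent:
  assumes "finite (carrier R)" "x \<in> carrier R"
  obtains n :: nat where "0 < n" "x [^] n \<otimes> x [^] n = x [^] n"
proof -
  have "range (\<lambda>n :: nat. x [^] n) \<subseteq> carrier R"
    using assms(2) by auto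
  then have "\<not> inj (\<lambda>n :: nat. x [^] n)"
    using finite_subset[OF _ assms(1)] finite_imageD infinite_UNIV_nat by blast
  then obtain i j :: nat where "i < j" "x [^] i = x [^] j"
    unfolding inj_def by (metis linorder_neqE_nat)
  then obtain p where p: "0 < p" "x [^] (i + p) = x [^] i"
    by (metis less_imp_add_positive)
  have step: "x [^] (m + p) = x [^] m" if im: "i \<le> m" for m
  proof -
    obtain k where k: "m = i + k"
      using le_Suc_ex[OF im] by auto
    have "x [^] (m + p) = x [^] (i + p + k)"
      by (simp add: k add.commute add.left_commute)
    also have "\<dots> = x [^] (i + p) \<otimes> x [^] k"
      using assms(2) by (rule nat_pow_mult[symmetric])
    also have "\<dots> = x [^] m"
      unfolding p(2) k using assms(2) by (rule nat_pow_mult)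
    finally show ?thesis .
  qed
  have steps: "x [^] (m + k * p) = x [^] m" if "i \<le> m" for m k
  proof (induction k)
    case (Suc k)
    then show ?case
      using step[of "m + k * p"] that by (simp add: add.commute add.left_commute)
  qed simp
  \<comment> \<open>A multiple of the period that is at least \<open>i\<close>; the added 1 keeps it
    positive when \<open>i = 0\<close>.\<close>
  let ?n = "(i + 1) * p"
  have "i \<le> ?n" "0 < ?n"
    using p(1) by (auto intro: order_trans[of i "i * p"])
  then have "x [^] ?n \<otimes> x [^] ?n = x [^] ?n"
    using steps[of ?n "i + 1"] nat_pow_mult[OF assms(2), of ?n ?n] by metis
  then show thesis
    using that \<open>0 < ?n\<close> by blast
qed

text \<open>The cofactor \<open>s\<close> is the geometric sum of the powers of \<open>a\<close>
  with exponents below \<open>n\<close>.\<close>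

lemma (in cring) one_minus_dvd_one_minus_pow:
  assumes "a \<in> carrier R"
  shows "\<exists>s\<in>carrier R. (\<one> \<ominus> a) \<otimes> s = \<one> \<ominus> a [^] (n :: nat)"
proof (induction n)
  case 0
  show ?case
    using assms by (intro bexI[of _ \<zero>]) (simp_all add: minus_eq r_neg)
next
  case (Suc n)
  then obtain s where s: "s \<in> carrier R" "(\<one> \<ominus> a) \<otimes> s = \<one> \<ominus> a [^] n"
    by blast
  have "(\<one> \<ominus> a) \<otimes> (s \<oplus> a [^] n) = (\<one> \<ominus> a) \<otimes> s \<oplus> (\<one> \<ominus> a) \<otimes> a [^] n"
    using s(1) assms by (simp add: r_distr)
  also have "\<dots> = (\<one> \<ominus> a [^] n) \<oplus> (a [^] n \<ominus> a \<otimes> a [^] n)"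
    using s assms by (simp add: minus_eq l_distr l_minus)
  also have "\<dots> = \<one> \<ominus> a [^] Suc n"
    using assms by (simp add: minus_eq a_assoc m_comm r_neg1)
  finally show ?case
    using s(1) assms by (intro bexI[of _ "s \<oplus> a [^] n"]) simp_all
qed

text \<open>Some positive power of a nonunit is idempotent, hence 0 or 1, and 1 would make it a
  unit. So nonunits are nilpotent; this makes them closed under addition, and they form the only
  maximal ideal.\<close>

lemma (in cring) local_ring_if_trivial_idempotents:
  assumes fin: "finite (carrier R)" and nontriv: "\<one> \<noteq> \<zero>"
    and idem: "\<And>e. \<lbrakk>e \<in> carrier R; e \<otimes> e = e\<rbrakk> \<Longrightarrow> e = \<zero> \<or> e = \<one>"
  shows "local_ring R"
proof -
  have nilpotent: "\<exists>n :: nat. x [^] n = \<zero>" if x: "x \<in> nonunits R" for x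
  proof -
    have xc: "x \<in> carrier R"
      using x by (simp add: nonunits_def)
    obtain n :: nat where n: "0 < n" "x [^] n \<otimes> x [^] n = x [^] n"
      using finite_power_idempotent[OF fin xc] by blast
    obtain m where m: "n = Suc m"
      using n(1) gr0_implies_Suc by blast
    have "x [^] n \<noteq> \<one>"
      using x xc unfolding m nonunits_def
      by (metis DiffE Units_one_closed m_comm nat_pow_Suc nat_pow_closed unit_factor)
    then show ?thesis
      using idem[of "x [^] n"] n(2) xc by auto
  qed
  \<comment> \<open>The element \<open>1 - a\<close> divides \<open>1 - a^n\<close>, which is 1 for
    a suitable exponent.\<close>
  have unit: "\<one> \<ominus> a \<in> Units R" if a: "a \<in> nonunits R" for a
  proof -
    have ac: "a \<in> carrier R"
      using a by (simp add: nonunits_def)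
    obtain n :: nat where "a [^] n = \<zero>"
      using nilpotent[OF a] by blast
    then obtain s where "s \<in> carrier R" "(\<one> \<ominus> a) \<otimes> s = \<one>"
      using one_minus_dvd_one_minus_pow[OF ac, of n] by (auto simp: minus_eq)
    then show ?thesis
      using ac unit_factor[of "\<one> \<ominus> a" s] by simp
  qed
  have add: "x \<oplus> y \<in> nonunits R" if x: "x \<in> nonunits R" and y: "y \<in> nonunits R" for x y
  proof (rule ccontr)
    have c: "x \<in> carrier R" "y \<in> carrier R"
      using x y by (auto simp: nonunits_def)
    assume "x \<oplus> y \<notin> nonunits R"
    then have u: "x \<oplus> y \<in> Units R"
      using c by (simp add: nonunits_def)
    \<comment> \<open>After scaling the sum to 1, \<open>?u y\<close> is a nonunit as a multiple of
      \<open>y\<close>, but also a unit, as it equals \<open>1 - ?u x\<close> with a nonunit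
      \<open>?u x\<close>.\<close>
    let ?u = "inv (x \<oplus> y)"
    have uc: "?u \<otimes> x \<in> carrier R" "?u \<otimes> y \<in> carrier R"
      using u c by simp_all
    have "?u \<otimes> y \<oplus> ?u \<otimes> x = \<one>"
      using u c by (simp add: r_distr[symmetric] a_comm)
    moreover have "?u \<otimes> y = (?u \<otimes> y \<oplus> ?u \<otimes> x) \<ominus> ?u \<otimes> x"
      using uc by (simp add: minus_eq a_assoc r_neg)
    ultimately have "?u \<otimes> y = \<one> \<ominus> ?u \<otimes> x"
      by simp
    moreover have "?u \<otimes> y \<in> nonunits R" "\<one> \<ominus> ?u \<otimes> x \<in> Units R"
      using mult_nonunit[OF x, of ?u] mult_nonunit[OF y, of ?u] u unit by simp_all
    ultimately show False
      by (simp add: nonunits_def)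
  qed
  have neg: "\<ominus> x \<in> nonunits R" if "x \<in> nonunits R" for x
    using mult_nonunit[OF that, of "\<ominus> \<one>"] that by (simp add: l_minus nonunits_def)
  have zero: "\<zero> \<in> nonunits R"
    using nontriv by (auto simp: nonunits_def Units_def)
  have ideal: "ideal (nonunits R) R"
  proof (rule idealI[OF ring_axioms])
    show "subgroup (nonunits R) (add_monoid R)"
      using add neg zero by unfold_locales (auto simp: nonunits_def a_inv_def[symmetric])
  qed (use mult_nonunit m_comm in \<open>auto simp: nonunits_def\<close>)
  have whole: "J = carrier R" if J: "ideal J R" "\<not> J \<subseteq> nonunits R" for J
  proof -
    interpret J: ideal J R by fact
    obtain u where u: "u \<in> J" "u \<in> Units R"
      using J(2) J.Icarr by (auto simp: nonunits_def)
    then have "inv u \<otimes> u \<in> J"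
      by (intro J.I_l_closed) auto
    then show ?thesis
      using u(2) J.one_imp_carrier by simp
  qed
  have max: "maximalideal (nonunits R) R"
    using ideal
  proof (rule maximalidealI)
    show "carrier R \<noteq> nonunits R"
      by (metis Diff_iff Units_one_closed nonunits_def one_closed)
    show "J = nonunits R \<or> J = carrier R" if "ideal J R" "nonunits R \<subseteq> J" for J
      using whole[OF that(1)] that(2) by blast
  qed
  moreover have "M = nonunits R" if "maximalideal M R" for M
  proof -
    interpret M: maximalideal M R by fact
    have "M \<subseteq> nonunits R"
      using whole[OF M.ideal_axioms] M.I_notcarr by blast
    then show ?thesis
      using M.I_maximal[OF ideal] maximalideal.I_notcarr[OF max] by (auto simp: nonunits_def)
  qed
  ultimately show ?thesis
    unfolding local_ring_def by blast
qed

section \<open>Units, principal ideals and planarity in direct products\<close>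

lemma Units_RDirProd: "(a, b) \<in> Units (RDirProd S T) \<longleftrightarrow> a \<in> Units S \<and> b \<in> Units T"
  by (auto simp: Units_def)

lemma nonunits_RDirProd:
  "(a, b) \<in> nonunits (RDirProd S T) \<longleftrightarrow>
    a \<in> nonunits S \<and> b \<in> carrier T \<or> a \<in> carrier S \<and> b \<in> nonunits T"
  by (auto simp: nonunits_def Units_RDirProd)

lemma cgenideal_RDirProd: "PIdl\<^bsub>RDirProd S T\<^esub> (a, b) = (PIdl\<^bsub>S\<^esub> a) \<times> (PIdl\<^bsub>T\<^esub> b)"
  by (fastforce simp: cgenideal_def)

lemma RDirProd_commute: "RDirProd S T \<simeq> RDirProd T S"
  using RDirProd_iso1[of S T] by (auto simp: is_ring_iso_def)

lemma RDirProd_cong: "\<lbrakk>S \<simeq> S'; T \<simeq> T'\<rbrakk> \<Longrightarrow> RDirProd S T \<simeq> RDirProd S' T'"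
  using RDirProd_iso6 unfolding is_ring_iso_def by blast

text \<open>A ring isomorphism maps nonunits to nonunits and multiples of \<open>z\<close> to
  multiples of its image, so it embeds one graph into the other.\<close>

lemma planar_graph_iso:
  assumes "R \<simeq> S" "cring R" "cring S" "planar (upper_ideal_relation_graph S)"
  shows "planar (upper_ideal_relation_graph R)"
proof -
  interpret R: cring R by fact
  interpret S: cring S by fact
  obtain h where h: "h \<in> ring_iso R S"
    using assms(1) by (auto simp: is_ring_iso_def)
  have non: "h x \<in> nonunits S" if "x \<in> nonunits R" for x
    using ring_iso_nonunits[OF h R.ring_axioms S.ring_axioms that] .
  show ?thesis
  proof (rule planar_embed[OF assms(4), of h]; (unfold fst_graph)?)
    show "inj_on h (nonunits R)"
      using ring_iso_memE(5)[OF h] by (auto simp: bij_betw_def nonunits_def intro: inj_on_subset)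
    show "h ` nonunits R \<subseteq> nonunits S"
      using non by blast
    fix e assume "e \<in> snd (upper_ideal_relation_graph R)"
    then obtain x y z where e: "e = {x, y}" "x \<noteq> y" "z \<in> nonunits R"
      "x \<in> PIdl\<^bsub>R\<^esub> z" "y \<in> PIdl\<^bsub>R\<^esub> z"
      unfolding R.edge_iff by metis
    have sub: "{x, y} \<subseteq> nonunits R"
      using e(3-5) R.cgenideal_nonunit by blast
    have "h w \<in> PIdl\<^bsub>S\<^esub> (h z)" if "w \<in> PIdl\<^bsub>R\<^esub> z" for w
      using that e(3) ring_iso_memE(1,2)[OF h] unfolding cgenideal_def nonunits_def by blast
    moreover have "h x \<noteq> h y"
      using ring_iso_memE(5)[OF h] e(2) sub by (auto simp: bij_betw_def nonunits_def inj_on_eq_iff)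
    ultimately have "{h x, h y} \<in> snd (upper_ideal_relation_graph S)"
      unfolding S.edge_iff using e(4,5) non[OF e(3)] by blast
    then show "e \<subseteq> nonunits R \<and> h ` e \<in> snd (upper_ideal_relation_graph S)"
      using e(1) sub by simp
  qed
qed

text \<open>Any two distinct multiples of \<open>z\<close> are adjacent with witness
  \<open>z\<close>, so \<open>PIdl z\<close> is a clique and cannot have five elements.\<close>

lemma (in cring) planar_card_cgenideal:
  assumes "planar (upper_ideal_relation_graph R)" "finite (carrier R)" "z \<in> nonunits R"
  shows "card (PIdl z) \<le> 4"
proof (rule planar_imp_no_K5[OF assms(1)])
  show sub: "PIdl z \<subseteq> fst (upper_ideal_relation_graph R)"
    using cgenideal_nonunit[OF assms(3)] by simp
  show "finite (PIdl z)"
    using finite_subset[OF sub] assms(2) by (simp add: nonunits_def)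
  show "{x, y} \<in> snd (upper_ideal_relation_graph R)" if "x \<in> PIdl z" "y \<in> PIdl z" "x \<noteq> y" for x y
    unfolding edge_iff using that assms(3) by blast
qed

lemma (in cring) cgenideal_one: "PIdl \<one> = carrier R"
  using r_one by (force simp: cgenideal_def)

lemma (in cring) cgenideal_zero: "PIdl \<zero> = {\<zero>}"
  by (force simp: cgenideal_def)

lemma (in cring) zero_nonunit: "\<one> \<noteq> \<zero> \<Longrightarrow> \<zero> \<in> nonunits R"
  by (auto simp: nonunits_def Units_def)

lemma (in cring) nonzero_in_cgenideal:
  assumes "a \<in> carrier R" "a \<noteq> \<zero>" "finite (carrier R)"
  shows "2 \<le> card (PIdl a)"
proof -
  have "{\<zero>, a} \<subseteq> PIdl a"
    using assms(1) cgenideal_self[of a] by (auto simp: cgenideal_def intro: exI[of _ \<zero>])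
  moreover have "PIdl a \<subseteq> carrier R"
    using assms(1) by (auto simp: cgenideal_def)
  ultimately have "card {\<zero>, a} \<le> card (PIdl a)"
    using assms(3) by (meson card_mono finite_subset)
  then show ?thesis
    using assms(2) by simp
qed

text \<open>For a nonunit \<open>b\<close>, the element \<open>(1, b)\<close> generates the clique
  \<open>S \<times> PIdl b\<close>. Taking \<open>b = 0\<close> bounds the order of \<open>S\<close>
  by 4; a nonzero \<open>b\<close> has at least two multiples, which halves the bound.\<close>

lemma planar_RDirProd_card:
  assumes "cring S" "cring T" "finite (carrier S)" "finite (carrier T)" "\<one>\<^bsub>T\<^esub> \<noteq> \<zero>\<^bsub>T\<^esub>"
    and "planar (upper_ideal_relation_graph (RDirProd S T))"
  shows "card (carrier S) \<le> 4"
    and "\<lbrakk>a \<in> nonunits T; a \<noteq> \<zero>\<^bsub>T\<^esub>\<rbrakk> \<Longrightarrow> card (carrier S) \<le> 2"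
proof -
  interpret S: cring S by fact
  interpret T: cring T by fact
  interpret P: cring "RDirProd S T"
    using assms(1,2) by (rule RDirProd_cring)
  have le: "card (carrier S) * card (PIdl\<^bsub>T\<^esub> b) \<le> 4" if "b \<in> nonunits T" for b
    using P.planar_card_cgenideal[OF assms(6), of "(\<one>\<^bsub>S\<^esub>, b)"] that assms(3,4)
    by (simp add: nonunits_RDirProd cgenideal_RDirProd S.cgenideal_one card_cartesian_product)
  show "card (carrier S) \<le> 4"
    using le[OF T.zero_nonunit[OF assms(5)]] by (simp add: T.cgenideal_zero)
  assume a: "a \<in> nonunits T" "a \<noteq> \<zero>\<^bsub>T\<^esub>"
  then have "card (carrier S) * 2 \<le> card (carrier S) * card (PIdl\<^bsub>T\<^esub> a)"
    using T.nonzero_in_cgenideal[of a] assms(4) by (simp add: nonunits_def)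
  then show "card (carrier S) \<le> 2"
    using le[OF a(1)] by linarith
qed

section \<open>Rings with at most four elements\<close>

text \<open>Both rings are labelled by the type \<open>'x\<close> and computed by the same tables
  \<open>P\<close> and \<open>M\<close> on labels; matching labels is then an isomorphism.\<close>

lemma ring_iso_by_tables:
  fixes f :: "'x \<Rightarrow> 'a" and g :: "'x \<Rightarrow> 'b"
  assumes "bij_betw f UNIV (carrier C)" "bij_betw g UNIV (carrier D)"
    and "f u = \<one>\<^bsub>C\<^esub>" "g u = \<one>\<^bsub>D\<^esub>"
    and "\<And>x y. f x \<oplus>\<^bsub>C\<^esub> f y = f (P x y)" "\<And>x y. g x \<oplus>\<^bsub>D\<^esub> g y = g (P x y)"
    and "\<And>x y. f x \<otimes>\<^bsub>C\<^esub> f y = f (M x y)" "\<And>x y. g x \<otimes>\<^bsub>D\<^esub> g y = g (M x y)"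
  shows "C \<simeq> D"
proof -
  let ?h = "g \<circ> inv_into UNIV f"
  have bij: "bij_betw ?h (carrier C) (carrier D)"
    using bij_betw_trans[OF bij_betw_inv_into[OF assms(1)] assms(2)] .
  have h: "?h (f x) = g x" for x
    using assms(1) by (simp add: bij_betw_def)
  have surj: "\<exists>x. c = f x" if "c \<in> carrier C" for c
    using that assms(1) by (auto simp: bij_betw_def)
  have "?h \<in> ring_iso C D"
  proof (rule ring_iso_memI[OF _ _ _ _ bij])
    fix c d assume "c \<in> carrier C" "d \<in> carrier C"
    then obtain x y where "c = f x" "d = f y"
      using surj by metis
    then show "?h c \<in> carrier D" "?h (c \<otimes>\<^bsub>C\<^esub> d) = ?h c \<otimes>\<^bsub>D\<^esub> ?h d"
      "?h (c \<oplus>\<^bsub>C\<^esub> d) = ?h c \<oplus>\<^bsub>D\<^esub> ?h d"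
      using assms(2,5-8) h by (auto simp: bij_betw_def)
  next
    show "?h \<one>\<^bsub>C\<^esub> = \<one>\<^bsub>D\<^esub>"
      unfolding assms(3)[symmetric] h by (rule assms(4))
  qed
  then show ?thesis
    by (auto simp: is_ring_iso_def)
qed

text \<open>In characteristic 2 the truth values are coordinates over the field with two elements
  with respect to 1 and \<open>a\<close>.\<close>

definition bits :: "('a, 'm) ring_scheme \<Rightarrow> 'a \<Rightarrow> bool \<times> bool \<Rightarrow> 'a"
  where "bits R a = (\<lambda>(i, j). (if i then \<one>\<^bsub>R\<^esub> else \<zero>\<^bsub>R\<^esub>) \<oplus>\<^bsub>R\<^esub> (if j then a else \<zero>\<^bsub>R\<^esub>))"

lemma (in cring) char2_double:
  assumes "\<one> \<oplus> \<one> = \<zero>" "x \<in> carrier R"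
  shows "x \<oplus> x = \<zero>"
proof -
  have "x \<oplus> x = (\<one> \<oplus> \<one>) \<otimes> x"
    using assms(2) by (simp only: l_distr one_closed l_one)
  then show ?thesis
    using assms by simp
qed

text \<open>In characteristic 2 an element other than 0 and 1 is linearly independent of 1, so the
  four combinations are distinct and exhaust the ring.\<close>

lemma (in cring) bits_bij:
  assumes card: "card (carrier R) = 4" and char: "\<one> \<oplus> \<one> = \<zero>" and nontriv: "\<one> \<noteq> \<zero>"
    and a: "a \<in> carrier R" "a \<noteq> \<zero>" "a \<noteq> \<one>"
  shows "bij_betw (bits R a) UNIV (carrier R)"
proof -
  have "\<one> \<oplus> a \<noteq> \<zero>"
    using a char add.r_cancel[of \<one> a \<one>] a_comm by (metis add.l_cancel one_closed)
  moreover have "\<one> \<oplus> a \<noteq> \<one>" "\<one> \<oplus> a \<noteq> a"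
    using a nontriv by auto
  ultimately have inj: "inj_on (bits R a) UNIV"
    using a nontriv by (auto simp: inj_on_def bits_def)
  have sub: "range (bits R a) \<subseteq> carrier R"
    using a(1) by (auto simp: bits_def)
  have "card (range (bits R a)) = 4"
    using card_image[OF inj] by (simp add: card_UNIV_bool)
  then have "range (bits R a) = carrier R"
    using card sub by (intro card_subset_eq) (auto simp: card_eq_0_iff intro!: card_ge_0_finite)
  then show ?thesis
    using inj by (simp add: bij_betw_def)
qed

lemma (in cring) bits_add:
  assumes "\<one> \<oplus> \<one> = \<zero>" "a \<in> carrier R"
  shows "bits R a u \<oplus> bits R a v = bits R a (fst u \<noteq> fst v, snd u \<noteq> snd v)"
proof -
  obtain i j k l where uv: "u = (i, j)" "v = (k, l)"
    by (metis surj_pair)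
  have "a \<oplus> a = \<zero>" "\<one> \<oplus> (\<one> \<oplus> a) = a" "a \<oplus> (\<one> \<oplus> a) = \<one>" "a \<oplus> \<one> = \<one> \<oplus> a"
    "(\<one> \<oplus> a) \<oplus> \<one> = a" "(\<one> \<oplus> a) \<oplus> a = \<one>" "(\<one> \<oplus> a) \<oplus> (\<one> \<oplus> a) = \<zero>"
  proof -
    show aa: "a \<oplus> a = \<zero>"
      using assms by (rule char2_double)
    show 1: "\<one> \<oplus> (\<one> \<oplus> a) = a"
      using assms a_assoc[of \<one> \<one> a] by simp
    show "(\<one> \<oplus> a) \<oplus> \<one> = a"
      using assms(2) 1 a_comm[of "\<one> \<oplus> a" \<one>] by simp
    show 2: "(\<one> \<oplus> a) \<oplus> a = \<one>"
      using assms(2) aa a_assoc[of \<one> a a] by simp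
    show "a \<oplus> (\<one> \<oplus> a) = \<one>"
      using assms(2) 2 a_comm[of a "\<one> \<oplus> a"] by simp
    show "a \<oplus> \<one> = \<one> \<oplus> a"
      using assms(2) by (intro a_comm) simp_all
    show "(\<one> \<oplus> a) \<oplus> (\<one> \<oplus> a) = \<zero>"
      using assms by (simp add: char2_double)
  qed
  then show ?thesis
    unfolding uv bits_def using assms by (cases i; cases j; cases k; cases l) simp_all
qed

text \<open>Expansion of \<open>(i + j a) (k + l a)\<close> with \<open>a^2\<close> replaced by
  \<open>p + q a\<close>; conjunction is the product of bits and inequality their sum modulo
  2.\<close>

lemma (in cring) bits_mult:
  assumes char: "\<one> \<oplus> \<one> = \<zero>" and a: "a \<in> carrier R" and sq: "a \<otimes> a = bits R a (p, q)"
  shows "bits R a u \<otimes> bits R a v = bits R a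
    ((fst u \<and> fst v) \<noteq> (snd u \<and> snd v \<and> p),
     ((fst u \<and> snd v) \<noteq> (snd u \<and> fst v)) \<noteq> (snd u \<and> snd v \<and> q))"
proof -
  obtain i j k l where uv: "u = (i, j)" "v = (k, l)"
    by (metis surj_pair)
  define c where "c i = (if i then \<one> else \<zero>)" for i
  have c: "c i \<in> carrier R" for i
    by (simp add: c_def)
  have bits: "bits R a (i, j) = c i \<oplus> c j \<otimes> a" for i j
    using a by (simp add: bits_def c_def)
  have "bits R a (i, j) \<otimes> bits R a (k, l) =
      (c i \<otimes> c k \<oplus> (c i \<otimes> c l) \<otimes> a) \<oplus> (((c j \<otimes> c k) \<otimes> a) \<oplus> (c j \<otimes> c l) \<otimes> (a \<otimes> a))"
    unfolding bits using c a by (simp add: l_distr r_distr m_ac a_ac)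
  also have "c i \<otimes> c k \<oplus> (c i \<otimes> c l) \<otimes> a = bits R a (i \<and> k, i \<and> l)"
    unfolding bits using a by (simp add: c_def)
  also have "(c j \<otimes> c k) \<otimes> a = bits R a (False, j \<and> k)"
    unfolding bits using a by (simp add: c_def)
  also have "(c j \<otimes> c l) \<otimes> (a \<otimes> a) = bits R a (j \<and> l \<and> p, j \<and> l \<and> q)"
    unfolding sq bits using a by (simp add: c_def)
  finally show ?thesis
    unfolding uv bits_add[OF char a] fst_conv snd_conv
    by (cases j; cases l; cases p; cases q) simp_all
qed

text \<open>The addition table is the same for all such rings, and the multiplication table depends
  only on the coordinates \<open>w\<close> of the square.\<close>

lemma order_4_char_2_iso:
  assumes "cring C" "card (carrier C) = 4" "\<one>\<^bsub>C\<^esub> \<oplus>\<^bsub>C\<^esub> \<one>\<^bsub>C\<^esub> = \<zero>\<^bsub>C\<^esub>" "\<one>\<^bsub>C\<^esub> \<noteq> \<zero>\<^bsub>C\<^esub>"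
    and "a \<in> carrier C" "a \<noteq> \<zero>\<^bsub>C\<^esub>" "a \<noteq> \<one>\<^bsub>C\<^esub>" "a \<otimes>\<^bsub>C\<^esub> a = bits C a w"
    and "cring D" "card (carrier D) = 4" "\<one>\<^bsub>D\<^esub> \<oplus>\<^bsub>D\<^esub> \<one>\<^bsub>D\<^esub> = \<zero>\<^bsub>D\<^esub>" "\<one>\<^bsub>D\<^esub> \<noteq> \<zero>\<^bsub>D\<^esub>"
    and "b \<in> carrier D" "b \<noteq> \<zero>\<^bsub>D\<^esub>" "b \<noteq> \<one>\<^bsub>D\<^esub>" "b \<otimes>\<^bsub>D\<^esub> b = bits D b w"
  shows "C \<simeq> D"
proof -
  obtain p q where w: "w = (p, q)"
    by (metis surj_pair)
  show ?thesis
  proof (rule ring_iso_by_tables)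
    show "bij_betw (bits C a) UNIV (carrier C)" "bij_betw (bits D b) UNIV (carrier D)"
      by (rule cring.bits_bij[OF assms(1-7)], rule cring.bits_bij[OF assms(9-15)])
    show "bits C a (True, False) = \<one>\<^bsub>C\<^esub>" "bits D b (True, False) = \<one>\<^bsub>D\<^esub>"
      using assms(1,9) by (simp_all add: bits_def cring.cring_simprules)
    show "bits C a u \<oplus>\<^bsub>C\<^esub> bits C a v = bits C a (fst u \<noteq> fst v, snd u \<noteq> snd v)"
      "bits D b u \<oplus>\<^bsub>D\<^esub> bits D b v = bits D b (fst u \<noteq> fst v, snd u \<noteq> snd v)" for u v
      by (rule cring.bits_add[OF assms(1,3,5)], rule cring.bits_add[OF assms(9,11,13)])
    show "bits C a u \<otimes>\<^bsub>C\<^esub> bits C a v = bits C a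
        ((fst u \<and> fst v) \<noteq> (snd u \<and> snd v \<and> p),
         ((fst u \<and> snd v) \<noteq> (snd u \<and> fst v)) \<noteq> (snd u \<and> snd v \<and> q))"
      "bits D b u \<otimes>\<^bsub>D\<^esub> bits D b v = bits D b
        ((fst u \<and> fst v) \<noteq> (snd u \<and> snd v \<and> p),
         ((fst u \<and> snd v) \<noteq> (snd u \<and> fst v)) \<noteq> (snd u \<and> snd v \<and> q))" for u v
      by (rule cring.bits_mult[OF assms(1,3,5) assms(8)[unfolded w]],
          rule cring.bits_mult[OF assms(9,11,13) assms(16)[unfolded w]])
  qed
qed

text \<open>The hypothesis \<open>order\<close> makes the additive order of 1 equal to the order of
  the ring. So the multiples of 1 fill the ring, and they multiply as integers modulo
  \<open>n\<close>.\<close>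

lemma (in cring) iso_residue_ring:
  assumes card: "card (carrier R) = n" and n: "1 < n"
    and order: "\<And>k :: nat. \<lbrakk>0 < k; k < n\<rbrakk> \<Longrightarrow> [k] \<cdot> \<one> \<noteq> \<zero>"
  shows "R \<simeq> residue_ring (int n)"
proof -
  interpret Z: residues "int n" "residue_ring (int n)"
    using n by unfold_locales auto
  define f :: "int \<Rightarrow> 'a" where "f k = [k] \<cdot> \<one>" for k
  have f_closed: "f k \<in> carrier R" for k
    by (simp add: f_def)
  have f_add: "f (k + l) = f k \<oplus> f l" for k l
    by (simp add: f_def add.int_pow_mult)
  have f_mult: "f (k * l) = f k \<otimes> f l" for k l
    by (simp add: f_def add_pow_ldistr_int add.int_pow_pow mult.commute)
  have f_nat: "f (int k) = [k] \<cdot> \<one>" for k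
    by (simp add: f_def add_pow_int_ge)
  have "f (int n) = \<zero>"
    using add.pow_order_eq_1[of \<one>] card by (simp add: f_nat order_def)
  then have f_mod: "f (k mod int n) = f k" for k
    using f_add[of "int n * (k div int n)" "k mod int n"] f_closed by (simp add: f_mult)
  have ne: "f k \<noteq> f l" if "0 \<le> k" "k < l" "l < int n" for k l
  proof
    assume "f k = f l"
    then have "f k \<oplus> f (l - k) = f k"
      using f_add[of k "l - k"] by simp
    then have "f (l - k) = \<zero>"
      using f_closed by simp
    moreover have "0 < nat (l - k)" "nat (l - k) < n" "int (nat (l - k)) = l - k"
      using that by linarith+
    ultimately show False
      using order[of "nat (l - k)"] f_nat[of "nat (l - k)"] by metis
  qed
  have "inj_on f {0..int n - 1}"
    by (rule linorder_inj_onI) (use ne in auto)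
  moreover from this have "f ` {0..int n - 1} = carrier R"
    using card n f_closed
    by (intro card_subset_eq) (auto simp: card_image intro: card_ge_0_finite)
  ultimately have "bij_betw f (carrier (residue_ring (int n))) (carrier R)"
    by (simp add: bij_betw_def residue_ring_def)
  then have "f \<in> ring_iso (residue_ring (int n)) R"
    by (intro ring_iso_memI) (simp_all add: residue_ring_def f_closed f_mod f_add f_mult, simp add: f_def)
  then show ?thesis
    using ring_iso_sym[OF cring.axioms(1)[OF Z.cring]] by (auto simp: is_ring_iso_def)
qed

section \<open>Rings of order 2 and 3, and of order 4 and characteristic 4\<close>

lemma (in cring) numeral_add_pow:
  "[(2 :: nat)] \<cdot> \<one> = \<one> \<oplus> \<one>" "[(3 :: nat)] \<cdot> \<one> = \<one> \<oplus> \<one> \<oplus> \<one>" "[(4 :: nat)] \<cdot> \<one> = (\<one> \<oplus> \<one>) \<oplus> (\<one> \<oplus> \<one>)"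
  by (simp_all add: numeral_eq_Suc add.nat_pow_Suc a_assoc)

lemma (in cring) card_add_pow: "[(card (carrier R))] \<cdot> \<one> = \<zero>"
  using add.pow_order_eq_1[of \<one>] by (simp add: order_def)

lemma (in cring) order_2_iso:
  assumes "card (carrier R) = 2" "\<one> \<noteq> \<zero>"
  shows "R \<simeq> residue_ring 2"
proof -
  have "[k] \<cdot> \<one> \<noteq> \<zero>" if "0 < k" "k < 2" for k :: nat
    using that assms(2) by (cases "k = 1") auto
  then show ?thesis
    using iso_residue_ring[OF assms(1)] by simp
qed

lemma (in cring) order_3_iso:
  assumes "card (carrier R) = 3" "\<one> \<noteq> \<zero>"
  shows "R \<simeq> residue_ring 3"
proof -
  have "\<one> \<oplus> \<one> \<noteq> \<zero>"
    using card_add_pow assms by (auto simp: numeral_add_pow)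
  moreover have "k = 1 \<or> k = 2" if "0 < k" "k < 3" for k :: nat
    using that by linarith
  ultimately have "[k] \<cdot> \<one> \<noteq> \<zero>" if "0 < k" "k < 3" for k :: nat
    using that assms(2) numeral_add_pow(1) add.nat_pow_eone[OF one_closed] by metis
  then show ?thesis
    using iso_residue_ring[OF assms(1)] by simp
qed

text \<open>The square is four times 1, which vanishes because the additive group has order
  4.\<close>

lemma (in cring) order_4_double_square:
  assumes "card (carrier R) = 4"
  shows "(\<one> \<oplus> \<one>) \<otimes> (\<one> \<oplus> \<one>) = \<zero>"
proof -
  have "(\<one> \<oplus> \<one>) \<otimes> (\<one> \<oplus> \<one>) = (\<one> \<oplus> \<one>) \<oplus> (\<one> \<oplus> \<one>)"
    by (simp only: l_distr one_closed l_one a_closed)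
  then show ?thesis
    using card_add_pow assms by (simp add: numeral_add_pow)
qed

lemma (in cring) order_4_char_4_iso:
  assumes card: "card (carrier R) = 4" and char: "\<one> \<oplus> \<one> \<noteq> \<zero>"
  shows "R \<simeq> residue_ring 4"
proof -
  have "\<one> \<oplus> \<one> \<oplus> \<one> \<noteq> \<zero>"
  proof
    assume "\<one> \<oplus> \<one> \<oplus> \<one> = \<zero>"
    moreover have "(\<one> \<oplus> \<one> \<oplus> \<one>) \<oplus> \<one> = \<zero>"
      using card_add_pow card by (simp add: numeral_add_pow a_assoc)
    ultimately have "\<one> = \<zero>"
      by simp
    then show False
      using char by simp
  qed
  moreover have "\<one> \<noteq> \<zero>"
    using char by auto
  moreover have "k = 1 \<or> k = 2 \<or> k = 3" if "0 < k" "k < 4" for k :: nat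
    using that by linarith
  ultimately have "[k] \<cdot> \<one> \<noteq> \<zero>" if "0 < k" "k < 4" for k :: nat
    using that char numeral_add_pow(1,2) add.nat_pow_eone[OF one_closed] by metis
  then show ?thesis
    using iso_residue_ring[OF card] by simp
qed

text \<open>With \<open>w = (p, q)\<close> this describes the ring
  \<open>F2[x]/(x^2 + q x + p)\<close> up to isomorphism, \<open>a\<close> being the class of
  \<open>x\<close>.\<close>

definition quadratic_over_F2 :: "('a, 'm) ring_scheme \<Rightarrow> bool \<times> bool \<Rightarrow> bool"
  where "quadratic_over_F2 C w \<longleftrightarrow> cring C \<and> card (carrier C) = 4 \<and>
    \<one>\<^bsub>C\<^esub> \<oplus>\<^bsub>C\<^esub> \<one>\<^bsub>C\<^esub> = \<zero>\<^bsub>C\<^esub> \<and> \<one>\<^bsub>C\<^esub> \<noteq> \<zero>\<^bsub>C\<^esub> \<and>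
    (\<exists>a\<in>carrier C. a \<noteq> \<zero>\<^bsub>C\<^esub> \<and> a \<noteq> \<one>\<^bsub>C\<^esub> \<and> a \<otimes>\<^bsub>C\<^esub> a = bits C a w)"

lemma quadratic_over_F2_iso:
  assumes "quadratic_over_F2 C w" "quadratic_over_F2 D w"
  shows "C \<simeq> D"
  using assms unfolding quadratic_over_F2_def by (elim conjE bexE) (rule order_4_char_2_iso)

lemma (in cring) bits_simps:
  assumes "a \<in> carrier R"
  shows "bits R a (False, False) = \<zero>" "bits R a (False, True) = a"
    "bits R a (True, False) = \<one>" "bits R a (True, True) = \<one> \<oplus> a"
  using assms by (simp_all add: bits_def)

text \<open>The fourth possible equation \<open>a^2 = 1\<close> turns into the first one for the
  generator \<open>1 + a\<close>, whose square is \<open>1 + 1 = 0\<close>.\<close>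

lemma (in cring) order_4_char_2:
  assumes card: "card (carrier R) = 4" and char: "\<one> \<oplus> \<one> = \<zero>" and nontriv: "\<one> \<noteq> \<zero>"
  shows "quadratic_over_F2 R (False, False) \<or> quadratic_over_F2 R (False, True) \<or>
    quadratic_over_F2 R (True, True)"
proof -
  have fin: "finite (carrier R)"
    using card by (intro card_ge_0_finite) simp
  have "\<not> carrier R \<subseteq> {\<zero>, \<one>}"
    using card_mono[of "{\<zero>, \<one>}" "carrier R"] card nontriv by auto
  then obtain a where a: "a \<in> carrier R" "a \<noteq> \<zero>" "a \<noteq> \<one>"
    by blast
  have quad: "quadratic_over_F2 R w"
    if "b \<in> carrier R" "b \<noteq> \<zero>" "b \<noteq> \<one>" "b \<otimes> b = bits R b w" for b w
    unfolding quadratic_over_F2_def using that card char nontriv cring_axioms by blast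
  have "a \<otimes> a \<in> range (bits R a)"
    using bits_bij[OF card char nontriv a] a(1) by (simp add: bij_betw_def)
  then obtain p q where sq: "a \<otimes> a = bits R a (p, q)"
    by (auto simp del: split_paired_All)
  show ?thesis
  proof (cases "p \<and> \<not> q")
    case True
    then have sq1: "a \<otimes> a = \<one>"
      using sq bits_simps[OF a(1)] by simp
    have b: "\<one> \<oplus> a \<noteq> \<zero>" "\<one> \<oplus> a \<noteq> \<one>"
      using a char add.l_cancel[of \<one> a \<one>] by auto
    have "(\<one> \<oplus> a) \<otimes> (\<one> \<oplus> a) = (\<one> \<oplus> a) \<oplus> (\<one> \<oplus> a)"
      using a(1) sq1 by (simp add: r_distr l_distr a_comm)
    then have "(\<one> \<oplus> a) \<otimes> (\<one> \<oplus> a) = bits R (\<one> \<oplus> a) (False, False)"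
      using a(1) char2_double[OF char] by (simp add: bits_simps)
    then show ?thesis
      using quad[of "\<one> \<oplus> a"] a(1) b by simp
  next
    case False
    then show ?thesis
      using quad[OF a sq] by (cases p; cases q) auto
  qed
qed

lemma (in cring) nilpotent_nonunit:
  assumes "t \<in> carrier R" "t \<otimes> t = \<zero>" "t \<noteq> \<zero>"
  shows "t \<in> nonunits R"
proof -
  have "t = \<zero>" if "t \<in> Units R"
    using Units_l_cancel[OF that, of t \<zero>] assms(1,2) by simp
  then show ?thesis
    using assms by (auto simp: nonunits_def)
qed

lemma (in cring) idempotent_nonunit:
  assumes "t \<in> carrier R" "t \<otimes> t = t" "t \<noteq> \<one>"
  shows "t \<in> nonunits R"
proof -
  have "t = \<one>" if "t \<in> Units R"
    using Units_l_cancel[OF that, of t \<one>] assms(1,2) by simp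
  then show ?thesis
    using assms by (auto simp: nonunits_def)
qed

text \<open>With first coordinate \<open>False\<close> the generator satisfies
  \<open>a^2 = 0\<close> or \<open>a^2 = a\<close>: it is nilpotent or an idempotent other than 1,
  in either case no unit.\<close>

lemma quadratic_over_F2_nonunit:
  assumes "quadratic_over_F2 C w" "\<not> fst w"
  shows "\<exists>t\<in>nonunits C. t \<noteq> \<zero>\<^bsub>C\<^esub>"
proof -
  interpret cring C
    using assms(1) by (simp add: quadratic_over_F2_def)
  obtain a where a: "a \<in> carrier C" "a \<noteq> \<zero>\<^bsub>C\<^esub>" "a \<noteq> \<one>\<^bsub>C\<^esub>" "a \<otimes>\<^bsub>C\<^esub> a = bits C a w"
    using assms(1) by (auto simp: quadratic_over_F2_def)
  obtain q where "w = (False, q)"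
    using assms(2) by (metis prod.collapse)
  then have "a \<otimes>\<^bsub>C\<^esub> a = \<zero>\<^bsub>C\<^esub> \<or> a \<otimes>\<^bsub>C\<^esub> a = a"
    using a(1,4) by (cases q) (simp_all add: bits_simps)
  then show ?thesis
    using a nilpotent_nonunit idempotent_nonunit by blast
qed

section \<open>The concrete rings of small order\<close>

lemma cring_residue_ring: "1 < n \<Longrightarrow> cring (residue_ring n)"
  by (rule residues.cring) (simp add: residues_def)

lemma residue_ring_simps:
  "carrier (residue_ring n) = {0..n - 1}" "x \<otimes>\<^bsub>residue_ring n\<^esub> y = x * y mod n"
  "x \<oplus>\<^bsub>residue_ring n\<^esub> y = (x + y) mod n" "\<one>\<^bsub>residue_ring n\<^esub> = 1" "\<zero>\<^bsub>residue_ring n\<^esub> = 0"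
  by (simp_all add: residue_ring_def)

lemma field_residue_ring: "field (residue_ring 2)" "field (residue_ring 3)"
  using residues_prime.is_field[of 2] residues_prime.is_field[of 3] by (simp_all add: residues_prime_def)

lemma Z2_Z2_quadratic:
  "quadratic_over_F2 (RDirProd (residue_ring 2) (residue_ring 2)) (False, True)"
  unfolding quadratic_over_F2_def
proof (intro conjI)
  let ?R = "RDirProd (residue_ring 2) (residue_ring 2)"
  show "cring ?R"
    by (intro RDirProd_cring cring_residue_ring) simp_all
  then interpret cring ?R .
  \<comment> \<open>The idempotent \<open>(1, 0)\<close> is a generator that satisfies
    \<open>a^2 = a\<close>.\<close>
  show "\<exists>a\<in>carrier ?R. a \<noteq> \<zero>\<^bsub>?R\<^esub> \<and> a \<noteq> \<one>\<^bsub>?R\<^esub> \<and> a \<otimes>\<^bsub>?R\<^esub> a = bits ?R a (False, True)"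
    by (rule bexI[of _ "(1, 0)"]) (simp_all add: bits_def residue_ring_simps)
qed (simp_all add: residue_ring_simps card_cartesian_product)

text \<open>A field has no zero divisors, so \<open>1 + 1\<close> vanishes along with its square. It
  has no nonzero nonunits, which leaves only the last of the three quadratic types.\<close>

lemma F4_quadratic: "quadratic_over_F2 F4 (True, True)"
proof -
  interpret field F4
    by (rule F4_field_order)
  have card: "card (carrier F4) = 4"
    using F4_field_order(2) by (simp add: order_def)
  have char: "\<one>\<^bsub>F4\<^esub> \<oplus>\<^bsub>F4\<^esub> \<one>\<^bsub>F4\<^esub> = \<zero>\<^bsub>F4\<^esub>"
    using order_4_double_square[OF card] integral by blast
  have "\<not> quadratic_over_F2 F4 w" if "\<not> fst w" for w
    using quadratic_over_F2_nonunit[OF _ that] field_Units by (auto simp: nonunits_def)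
  then show ?thesis
    using order_4_char_2[OF card char] by auto
qed

text \<open>The class of \<open>x\<close>, the list \<open>[1, 0]\<close>, is the generator with
  square zero; the order 4 comes from the four remainders modulo \<open>x^2\<close>.\<close>

lemma Z2_dual_quadratic: "quadratic_over_F2 Z2_dual (False, False)"
proof -
  let ?R = "residue_ring 2"
  let ?P = "(carrier ?R)[X]\<^bsub>?R\<^esub>"
  interpret Z: residues_prime 2 ?R
    by unfold_locales auto
  note sub = Z.carrier_is_subfield
  note subr = subfieldE(1)[OF sub]
  interpret P: domain ?P
    using Z.univ_poly_is_domain[OF subr] .
  have poly: "[1, 0, 0] \<in> carrier ?P" "[1, 0] \<in> carrier ?P" "[1] \<in> carrier ?P" "[] \<in> carrier ?P"
    by (simp_all add: univ_poly_def polynomial_def residue_ring_def)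
  have ring: "Z2_dual = ?P Quot (PIdl\<^bsub>?P\<^esub> [1, 0, 0])"
    by (simp add: Z2_dual_def rupture_def)
  have cring: "cring Z2_dual"
    unfolding ring using P.cgenideal_ideal[OF poly(1)] P.cring_axioms by (rule ideal.quotient_is_cring)
  let ?s = "Z.rupture_surj (carrier ?R) [1, 0, 0]"
  have hom: "?s \<in> ring_hom ?P Z2_dual"
    unfolding Z2_dual_def by (rule Z.rupture_surj_hom(1)[OF subr poly(1)])
  interpret S: cring Z2_dual by (rule cring)
  have zero: "?s [] = \<zero>\<^bsub>Z2_dual\<^esub>"
    using ring_hom_zero[OF hom P.ring_axioms S.ring_axioms] by (simp add: univ_poly_zero)
  have one: "?s [1] = \<one>\<^bsub>Z2_dual\<^esub>"
    using ring_hom_one[OF hom] by (simp add: univ_poly_one residue_ring_simps)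
  have small: "q = [] \<or> q = [1] \<or> q = [1, 0] \<or> q = [1, 1]"
    if "q \<in> carrier ?P" "length q \<le> 2" for q
  proof -
    have bit: "a = 0 \<or> a = 1" if "a \<in> carrier ?R" for a
      using that by (auto simp: residue_ring_def)
    from that(2) consider "q = []" | a where "q = [a]" | a b where "q = [a, b]"
      by (cases q; cases "tl q"; auto)
    then show ?thesis
      using that(1) bit
      by cases (auto simp: univ_poly_def polynomial_def residue_ring_def)
  qed
  \<comment> \<open>The length of a nonzero polynomial exceeds its degree by one, so these are 0 and
    the polynomials of degree below two.\<close>
  have "{q \<in> carrier ?P. length q \<le> degree [1, 0, 0 :: int]} = {[], [1], [1, 0], [1, 1]}"
    (is "?A = ?B")
  proof
    show "?A \<subseteq> ?B"
      using small by fastforce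
    show "?B \<subseteq> ?A"
      by (auto simp: univ_poly_def polynomial_def residue_ring_def)
  qed
  then have mods: "(\<lambda>q. Z.pmod q [1, 0, 0]) ` carrier ?P = {[], [1], [1, 0], [1, 1]}"
    using Z.pmod_image_characterization[OF sub poly(1)] by simp
  have inj: "inj_on ?s {[], [1], [1, 0], [1, 1]}"
    using Z.rupture_surj_inj_on[OF sub poly(1)] unfolding mods .
  have "carrier Z2_dual = ?s ` {[], [1], [1, 0], [1, 1]}"
    using Z.rupture_carrier_as_pmod_image[OF sub poly(1)] unfolding mods Z2_dual_def by simp
  then have card: "card (carrier Z2_dual) = 4"
    using card_image[OF inj] by simp
  have "[1] \<oplus>\<^bsub>?P\<^esub> [1] = []"
    by (simp add: univ_poly_add residue_ring_simps)
  then have char: "\<one>\<^bsub>Z2_dual\<^esub> \<oplus>\<^bsub>Z2_dual\<^esub> \<one>\<^bsub>Z2_dual\<^esub> = \<zero>\<^bsub>Z2_dual\<^esub>"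
    using ring_hom_add[OF hom poly(3) poly(3)] one zero by simp
  have "[1, 0] \<otimes>\<^bsub>?P\<^esub> [1, 0] = [1, 0, 0]"
    by (simp add: univ_poly_mult residue_ring_simps)
  moreover have "?s [1, 0, 0] = \<zero>\<^bsub>Z2_dual\<^esub>"
    unfolding ring using poly(1)
    by (simp add: FactRing_def P.a_rcos_zero P.cgenideal_ideal P.cgenideal_self)
  ultimately have sq: "?s [1, 0] \<otimes>\<^bsub>Z2_dual\<^esub> ?s [1, 0] = \<zero>\<^bsub>Z2_dual\<^esub>"
    using ring_hom_mult[OF hom poly(2) poly(2)] by simp
  have ne: "?s [1, 0] \<noteq> \<zero>\<^bsub>Z2_dual\<^esub>" "?s [1, 0] \<noteq> \<one>\<^bsub>Z2_dual\<^esub>" "\<one>\<^bsub>Z2_dual\<^esub> \<noteq> \<zero>\<^bsub>Z2_dual\<^esub>"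
    unfolding zero[symmetric] one[symmetric] by (subst inj_on_eq_iff[OF inj]; simp)+
  have carr: "?s [1, 0] \<in> carrier Z2_dual"
    using ring_hom_closed[OF hom poly(2)] .
  show ?thesis
    unfolding quadratic_over_F2_def
    using cring card char ne carr sq S.bits_simps(1)[OF carr] by metis
qed

text \<open>Rings with a nonzero nonunit are kept apart from the fields, because such an element in
  one factor of a product will bound the order of the other factor by 2.\<close>

lemma small_ring_cases:
  assumes "cring C" "finite (carrier C)" "\<one>\<^bsub>C\<^esub> \<noteq> \<zero>\<^bsub>C\<^esub>" "card (carrier C) \<le> 4"
  shows "C \<simeq> residue_ring 2 \<or> C \<simeq> residue_ring 3 \<or> C \<simeq> F4 \<or>
    (\<exists>t\<in>nonunits C. t \<noteq> \<zero>\<^bsub>C\<^esub>) \<and>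
    (C \<simeq> residue_ring 4 \<or> C \<simeq> Z2_dual \<or> C \<simeq> RDirProd (residue_ring 2) (residue_ring 2))"
proof -
  interpret cring C by fact
  have "card {\<zero>\<^bsub>C\<^esub>, \<one>\<^bsub>C\<^esub>} \<le> card (carrier C)"
    using assms(2) by (intro card_mono) auto
  then have "2 \<le> card (carrier C)"
    using assms(3) by simp
  then consider "card (carrier C) = 2" | "card (carrier C) = 3" | "card (carrier C) = 4"
    using assms(4) by linarith
  then show ?thesis
  proof cases
    case 1
    then show ?thesis
      using order_2_iso assms(3) by simp
  next
    case 2
    then show ?thesis
      using order_3_iso assms(3) by simp
  next
    case 3
    show ?thesis
    proof (cases "\<one>\<^bsub>C\<^esub> \<oplus>\<^bsub>C\<^esub> \<one>\<^bsub>C\<^esub> = \<zero>\<^bsub>C\<^esub>")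
      case False
      then have "\<one>\<^bsub>C\<^esub> \<oplus>\<^bsub>C\<^esub> \<one>\<^bsub>C\<^esub> \<in> nonunits C"
        by (intro nilpotent_nonunit order_4_double_square 3) auto
      then show ?thesis
        using order_4_char_4_iso[OF 3 False] False by blast
    next
      case True
      consider "quadratic_over_F2 C (False, False)" | "quadratic_over_F2 C (False, True)" |
        "quadratic_over_F2 C (True, True)"
        using order_4_char_2[OF 3 True assms(3)] by blast
      then show ?thesis
      proof cases
        case 1
        then show ?thesis
          using quadratic_over_F2_iso[OF 1 Z2_dual_quadratic] quadratic_over_F2_nonunit[OF 1] by simp
      next
        case 2
        then show ?thesis
          using quadratic_over_F2_iso[OF 2 Z2_Z2_quadratic] quadratic_over_F2_nonunit[OF 2] by simp
      next
        case 3
        then show ?thesis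
          using quadratic_over_F2_iso[OF 3 F4_quadratic] by simp
      qed
    qed
  qed
qed

section \<open>The nine planar graphs\<close>

lemma nonunits_field: "field S \<Longrightarrow> nonunits S = {\<zero>\<^bsub>S\<^esub>}"
  using field.field_Units cring.cring_simprules(2)[OF fieldE(1)]
  by (fastforce simp: nonunits_def)

lemma cgenideal_subset_carrier:
  assumes "cring S" "z \<in> carrier S"
  shows "PIdl\<^bsub>S\<^esub> z \<subseteq> carrier S"
proof -
  interpret cring S by fact
  show ?thesis
    using assms(2) by (auto simp: cgenideal_def)
qed

text \<open>A nonunit \<open>(z1, z2)\<close> has a nonunit component, all of whose multiples are
  nonunits; so its ideal lies in one of the two sets.\<close>

lemma RDirProd_edge:
  assumes "cring S" "cring T" "e \<in> snd (upper_ideal_relation_graph (RDirProd S T))"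
  shows "\<exists>x y. e = {x, y} \<and> x \<noteq> y \<and>
    ({x, y} \<subseteq> nonunits S \<times> carrier T \<or> {x, y} \<subseteq> carrier S \<times> nonunits T)"
proof -
  interpret S: cring S by fact
  interpret T: cring T by fact
  interpret P: cring "RDirProd S T"
    using assms(1,2) by (rule RDirProd_cring)
  obtain x y z1 z2 where e: "e = {x, y}" "x \<noteq> y" "(z1, z2) \<in> nonunits (RDirProd S T)"
    "{x, y} \<subseteq> (PIdl\<^bsub>S\<^esub> z1) \<times> (PIdl\<^bsub>T\<^esub> z2)"
    using assms(3) unfolding P.edge_iff cgenideal_RDirProd[symmetric] by auto
  have "(PIdl\<^bsub>S\<^esub> z1) \<times> (PIdl\<^bsub>T\<^esub> z2) \<subseteq> nonunits S \<times> carrier T \<or>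
      (PIdl\<^bsub>S\<^esub> z1) \<times> (PIdl\<^bsub>T\<^esub> z2) \<subseteq> carrier S \<times> nonunits T"
    using e(3) S.cgenideal_nonunit T.cgenideal_nonunit cgenideal_subset_carrier assms(1,2)
    unfolding nonunits_RDirProd by (metis Sigma_mono)
  then show ?thesis
    using e(1,2,4) by (intro exI[of _ x] exI[of _ y]) (meson subset_trans)
qed

lemma nonunits_RDirProd_eq:
  "nonunits (RDirProd S T) = nonunits S \<times> carrier T \<union> carrier S \<times> nonunits T"
  using nonunits_RDirProd[of _ _ S T] by auto

lemma graph_eta: "upper_ideal_relation_graph R = (nonunits R, snd (upper_ideal_relation_graph R))"
  by (metis fst_graph prod.collapse)

text \<open>The only nonunit of a field is 0, so the vertices form the axes
  \<open>{0} \<times> T\<close> and \<open>S \<times> {0}\<close>, which share the origin and have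
  at most four elements each.\<close>

lemma planar_field_RDirProd:
  assumes "field S" "field T" "finite (carrier S)" "finite (carrier T)"
    and "card (carrier S) \<le> 4" "card (carrier T) \<le> 4"
  shows "planar (upper_ideal_relation_graph (RDirProd S T))"
proof -
  interpret S: field S by fact
  interpret T: field T by fact
  let ?A = "{\<zero>\<^bsub>S\<^esub>} \<times> carrier T" and ?B = "carrier S \<times> {\<zero>\<^bsub>T\<^esub>}"
  let ?E = "snd (upper_ideal_relation_graph (RDirProd S T))"
  have "planar (?A \<union> ?B, ?E)"
  proof (rule planar_two_cliques_sharing_vertex)
    show "?A \<inter> ?B = {(\<zero>\<^bsub>S\<^esub>, \<zero>\<^bsub>T\<^esub>)}"
      by auto
    show "\<exists>x y. e = {x, y} \<and> x \<noteq> y \<and> ({x, y} \<subseteq> ?A \<or> {x, y} \<subseteq> ?B)" if "e \<in> ?E" for e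
      using RDirProd_edge[OF S.cring_axioms T.cring_axioms that]
      unfolding nonunits_field[OF assms(1)] nonunits_field[OF assms(2)] .
  qed (use assms(3-6) in \<open>simp_all add: card_cartesian_product\<close>)
  then show ?thesis
    by (subst graph_eta) (simp only: nonunits_RDirProd_eq nonunits_field[OF assms(1)]
        nonunits_field[OF assms(2)])
qed

text \<open>As \<open>t\<close> squares to zero, \<open>1 - t\<close> is the inverse of
  \<open>1 + t\<close>. Hence \<open>1 + t\<close> differs from 0, and the four listed elements
  exhaust the ring.\<close>

lemma (in cring) order_4_nilpotent:
  assumes card: "card (carrier R) = 4" and t: "t \<in> carrier R" "t \<otimes> t = \<zero>" "t \<noteq> \<zero>"
  shows "nonunits R = {\<zero>, t}" "carrier R = {\<zero>, t, \<one>, \<one> \<oplus> t}" "distinct [\<zero>, t, \<one>, \<one> \<oplus> t]"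
proof -
  have nontriv: "\<one> \<noteq> \<zero>"
    using t by (metis l_null l_one)
  have t1: "t \<noteq> \<one>"
    using t(2) nontriv by auto
  have unit: "\<one> \<oplus> t \<in> Units R"
  proof -
    have "(\<one> \<oplus> t) \<otimes> (\<one> \<oplus> \<ominus> t) = \<one>"
      using t(1,2) by (simp add: r_distr l_distr r_minus a_assoc r_neg)
    then show ?thesis
      using t(1) unit_factor[of "\<one> \<oplus> t" "\<one> \<oplus> \<ominus> t"] by simp
  qed
  have zero: "\<zero> \<in> nonunits R"
    using zero_nonunit[OF nontriv] .
  have "\<one> \<oplus> t \<noteq> \<zero>"
    using unit zero by (auto simp: nonunits_def)
  moreover have "\<one> \<oplus> t \<noteq> \<one>" "\<one> \<oplus> t \<noteq> t"
    using t(1,3) nontriv by simp_all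
  ultimately show dist: "distinct [\<zero>, t, \<one>, \<one> \<oplus> t]"
    using t(3) t1 nontriv by auto
  have fin: "finite (carrier R)"
    using card by (intro card_ge_0_finite) simp
  show carr: "carrier R = {\<zero>, t, \<one>, \<one> \<oplus> t}"
  proof (rule card_subset_eq[symmetric, OF fin])
    show "{\<zero>, t, \<one>, \<one> \<oplus> t} \<subseteq> carrier R"
      using t(1) by simp
    show "card {\<zero>, t, \<one>, \<one> \<oplus> t} = card (carrier R)"
      using distinct_card[OF dist] card by simp
  qed
  show "nonunits R = {\<zero>, t}"
  proof
    show "nonunits R \<subseteq> {\<zero>, t}"
      unfolding nonunits_def using carr unit Units_one_closed by blast
    show "{\<zero>, t} \<subseteq> nonunits R"
      using zero nilpotent_nonunit[OF t] by simp
  qed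
qed

text \<open>The nonunits of \<open>T\<close> are 0 and \<open>t\<close>, so
  \<open>{0} \<times> T\<close> and \<open>S \<times> {0, t}\<close> have four elements each and
  share the pair \<open>(0, 0)\<close>, \<open>(0, t)\<close>.\<close>

lemma planar_RDirProd_order_2_4:
  assumes "field S" "card (carrier S) = 2" "cring T" "card (carrier T) = 4"
    and "t \<in> carrier T" "t \<otimes>\<^bsub>T\<^esub> t = \<zero>\<^bsub>T\<^esub>" "t \<noteq> \<zero>\<^bsub>T\<^esub>"
  shows "planar (upper_ideal_relation_graph (RDirProd S T))"
proof -
  interpret S: field S by fact
  interpret T: cring T by fact
  note T = T.order_4_nilpotent[OF assms(4-7)]
  have S: "carrier S = {\<zero>\<^bsub>S\<^esub>, \<one>\<^bsub>S\<^esub>}"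
  proof (rule card_subset_eq[symmetric])
    show "finite (carrier S)"
      using assms(2) by (intro card_ge_0_finite) simp
  qed (use assms(2) in simp_all)
  let ?V = "{(\<zero>\<^bsub>S\<^esub>, \<zero>\<^bsub>T\<^esub>), (\<zero>\<^bsub>S\<^esub>, t), (\<zero>\<^bsub>S\<^esub>, \<one>\<^bsub>T\<^esub>), (\<zero>\<^bsub>S\<^esub>, \<one>\<^bsub>T\<^esub> \<oplus>\<^bsub>T\<^esub> t), (\<one>\<^bsub>S\<^esub>, \<zero>\<^bsub>T\<^esub>), (\<one>\<^bsub>S\<^esub>, t)}"
  let ?E = "snd (upper_ideal_relation_graph (RDirProd S T))"
  have A: "nonunits S \<times> carrier T =
      {(\<zero>\<^bsub>S\<^esub>, \<zero>\<^bsub>T\<^esub>), (\<zero>\<^bsub>S\<^esub>, t), (\<zero>\<^bsub>S\<^esub>, \<one>\<^bsub>T\<^esub>), (\<zero>\<^bsub>S\<^esub>, \<one>\<^bsub>T\<^esub> \<oplus>\<^bsub>T\<^esub> t)}"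
    unfolding nonunits_field[OF assms(1)] T(2) by auto
  have B: "carrier S \<times> nonunits T = {(\<zero>\<^bsub>S\<^esub>, \<zero>\<^bsub>T\<^esub>), (\<zero>\<^bsub>S\<^esub>, t), (\<one>\<^bsub>S\<^esub>, \<zero>\<^bsub>T\<^esub>), (\<one>\<^bsub>S\<^esub>, t)}"
    unfolding S T(1) by auto
  have V: "nonunits (RDirProd S T) = ?V"
    unfolding nonunits_RDirProd_eq A B by auto
  have "planar (?V, ?E)"
  proof (rule planar_two_cliques_sharing_edge)
    show "distinct [(\<zero>\<^bsub>S\<^esub>, \<zero>\<^bsub>T\<^esub>), (\<zero>\<^bsub>S\<^esub>, t), (\<zero>\<^bsub>S\<^esub>, \<one>\<^bsub>T\<^esub>), (\<zero>\<^bsub>S\<^esub>, \<one>\<^bsub>T\<^esub> \<oplus>\<^bsub>T\<^esub> t), (\<one>\<^bsub>S\<^esub>, \<zero>\<^bsub>T\<^esub>), (\<one>\<^bsub>S\<^esub>, t)]"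
      using T(3) S.one_not_zero by simp
    show "\<exists>x y. e = {x, y} \<and> x \<noteq> y \<and>
        ({x, y} \<subseteq> {(\<zero>\<^bsub>S\<^esub>, \<zero>\<^bsub>T\<^esub>), (\<zero>\<^bsub>S\<^esub>, t), (\<zero>\<^bsub>S\<^esub>, \<one>\<^bsub>T\<^esub>), (\<zero>\<^bsub>S\<^esub>, \<one>\<^bsub>T\<^esub> \<oplus>\<^bsub>T\<^esub> t)} \<or>
         {x, y} \<subseteq> {(\<zero>\<^bsub>S\<^esub>, \<zero>\<^bsub>T\<^esub>), (\<zero>\<^bsub>S\<^esub>, t), (\<one>\<^bsub>S\<^esub>, \<zero>\<^bsub>T\<^esub>), (\<one>\<^bsub>S\<^esub>, t)})" if "e \<in> ?E" for e
      using RDirProd_edge[OF S.cring_axioms T.cring_axioms that] unfolding A B .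
  qed
  then show ?thesis
    by (subst graph_eta) (simp only: V)
qed

lemma planar_Z2_Z2_Z2:
  "planar (upper_ideal_relation_graph
     (RDirProd (residue_ring 2) (RDirProd (residue_ring 2) (residue_ring 2))))"
proof -
  let ?Z = "residue_ring 2"
  let ?T = "RDirProd ?Z ?Z"
  let ?R = "RDirProd ?Z ?T"
  have Z: "cring ?Z" "cring ?T" "cring ?R"
    by (intro RDirProd_cring cring_residue_ring; simp)+
  have carr: "carrier ?Z = {0, 1}"
    by (auto simp: residue_ring_simps)
  have non: "nonunits ?Z = {0}"
    using nonunits_field[OF field_residue_ring(1)] by (simp add: residue_ring_simps)
  \<comment> \<open>A triple of bits is read as a binary number. The only unit
    \<open>(1, 1, 1)\<close> would be 7, so the vertices receive 0 to 6.\<close>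
  define \<phi> :: "int \<times> int \<times> int \<Rightarrow> nat" where "\<phi> = (\<lambda>(a, b, c). nat (a + 2 * b + 4 * c))"
  let ?E = "snd (upper_ideal_relation_graph ?R)"
  have "planar (nonunits ?R, ?E)"
  proof (rule planar_common_zero_digit_embed)
    show "inj_on \<phi> (nonunits ?R)" "\<phi> ` nonunits ?R \<subseteq> {..<7}"
      unfolding nonunits_RDirProd_eq RDirProd_simps carr non by (auto simp: \<phi>_def inj_on_def)
    fix e assume "e \<in> ?E"
    then obtain x y z1 z2 z3 where e: "e = {x, y}" "x \<noteq> y" "(z1, z2, z3) \<in> nonunits ?R"
      "{x, y} \<subseteq> PIdl\<^bsub>?R\<^esub> (z1, z2, z3)"
      unfolding cring.edge_iff[OF Z(3)] by auto
    have zero: "PIdl\<^bsub>?Z\<^esub> 0 = {0}"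
      using cring.cgenideal_zero[OF Z(1)] by (simp add: residue_ring_simps)
    have le: "PIdl\<^bsub>?Z\<^esub> z \<subseteq> {0, 1}" if "z \<in> {0, 1}" for z
      using cgenideal_subset_carrier[OF Z(1)] that unfolding carr .
    have z: "z1 \<in> {0, 1}" "z2 \<in> {0, 1}" "z3 \<in> {0, 1}" "z1 = 0 \<or> z2 = 0 \<or> z3 = 0"
      using e(3) unfolding nonunits_RDirProd_eq RDirProd_simps carr non by auto
    \<comment> \<open>A nonunit has a zero coordinate, in which all its multiples vanish;
      \<open>\<phi>\<close> maps the three sets onto the cliques of
      \<open>common_zero_digit\<close>.\<close>
    have "PIdl\<^bsub>?R\<^esub> (z1, z2, z3) \<subseteq> {0, 1} \<times> {0, 1} \<times> {0} \<or>
        PIdl\<^bsub>?R\<^esub> (z1, z2, z3) \<subseteq> {0, 1} \<times> {0} \<times> {0, 1} \<or>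
        PIdl\<^bsub>?R\<^esub> (z1, z2, z3) \<subseteq> {0} \<times> {0, 1} \<times> {0, 1}"
      unfolding cgenideal_RDirProd using z(4) le[OF z(1)] le[OF z(2)] le[OF z(3)] zero
      by (metis Sigma_mono order_refl)
    then have "\<phi> ` {x, y} \<subseteq> \<phi> ` ({0, 1} \<times> {0, 1} \<times> {0}) \<or> \<phi> ` {x, y} \<subseteq> \<phi> ` ({0, 1} \<times> {0} \<times> {0, 1}) \<or>
        \<phi> ` {x, y} \<subseteq> \<phi> ` ({0} \<times> {0, 1} \<times> {0, 1})"
      using e(4) by (meson image_mono subset_trans)
    moreover have "\<phi> ` ({0, 1} \<times> {0, 1} \<times> {0}) = {0, 1, 2, 3}" "\<phi> ` ({0, 1} \<times> {0} \<times> {0, 1}) = {0, 1, 4, 5}"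
      "\<phi> ` ({0} \<times> {0, 1} \<times> {0, 1}) = {0, 2, 4, 6}"
      by (auto simp: \<phi>_def image_iff)
    moreover have "{x, y} \<subseteq> nonunits ?R"
      using e(3,4) cring.cgenideal_nonunit[OF Z(3)] by blast
    ultimately have "e = {x, y} \<and> x \<noteq> y \<and> {x, y} \<subseteq> nonunits ?R \<and>
        ({\<phi> x, \<phi> y} \<subseteq> {0, 1, 2, 3} \<or> {\<phi> x, \<phi> y} \<subseteq> {0, 1, 4, 5} \<or> {\<phi> x, \<phi> y} \<subseteq> {0, 2, 4, 6})"
      using e(1,2) unfolding image_insert image_empty by metis
    then show "\<exists>x y. e = {x, y} \<and> x \<noteq> y \<and> {x, y} \<subseteq> nonunits ?R \<and>
        ({\<phi> x, \<phi> y} \<subseteq> {0, 1, 2, 3} \<or> {\<phi> x, \<phi> y} \<subseteq> {0, 1, 4, 5} \<or> {\<phi> x, \<phi> y} \<subseteq> {0, 2, 4, 6})"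
      by (intro exI)
  qed
  then show ?thesis
    by (subst graph_eta)
qed

text \<open>A non-local ring has an idempotent \<open>e\<close> other than 0 and 1. The factors
  \<open>eR\<close> and \<open>(1 - e)R\<close> are nonzero because their units \<open>e\<close> and
  \<open>1 - e\<close> are.\<close>

lemma nonlocal_RDirProd:
  fixes R :: "('a, 'm) ring_scheme" (structure)
  assumes "cring R" "finite (carrier R)" "\<one> \<noteq> \<zero>" "\<not> local_ring R"
  obtains S T :: "'a ring" where "R \<simeq> RDirProd S T" "cring S" "cring T"
    "finite (carrier S)" "finite (carrier T)" "\<one>\<^bsub>S\<^esub> \<noteq> \<zero>\<^bsub>S\<^esub>" "\<one>\<^bsub>T\<^esub> \<noteq> \<zero>\<^bsub>T\<^esub>"
proof -
  interpret cring R by fact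
  obtain e where e: "e \<in> carrier R" "e \<otimes> e = e" "e \<noteq> \<zero>" "e \<noteq> \<one>"
    using local_ring_if_trivial_idempotents assms(2-4) by blast
  let ?f = "\<one> \<ominus> e"
  have f: "?f \<in> carrier R" "?f \<otimes> ?f = ?f" "?f \<noteq> \<zero>"
  proof -
    show "?f \<in> carrier R"
      using e(1) by simp
    have "e \<otimes> ?f = \<zero>"
      using e(1,2) by (simp add: minus_eq r_distr r_minus r_neg)
    then show "?f \<otimes> ?f = ?f"
      using e(1) by (simp add: minus_eq l_distr l_minus)
    show "?f \<noteq> \<zero>"
      using e(1,4) by simp
  qed
  show thesis
  proof (rule that[OF idempotent_decomposition[OF e(1,2)]])
    show "cring (corner R e)" "cring (corner R ?f)"
      using corner_cring e f by simp_all
    show "finite (carrier (corner R e))" "finite (carrier (corner R ?f))"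
      using assms(2) by (simp_all add: corner_def)
    show "\<one>\<^bsub>corner R e\<^esub> \<noteq> \<zero>\<^bsub>corner R e\<^esub>" "\<one>\<^bsub>corner R ?f\<^esub> \<noteq> \<zero>\<^bsub>corner R ?f\<^esub>"
      using e(3) f(3) by (simp_all add: corner_def)
  qed
qed

section \<open>Classification of the non-local rings with planar graph\<close>

theorem theorem4p3:
  fixes R :: "('a, 'm) ring_scheme" (structure)
  assumes "cring R" and "finite (carrier R)" and "\<one> \<noteq> \<zero>" and "\<not> local_ring R"
  shows "planar (upper_ideal_relation_graph R) \<longleftrightarrow>
      R \<simeq> RDirProd (residue_ring 2) (RDirProd (residue_ring 2) (residue_ring 2)) \<or>
      R \<simeq> RDirProd (residue_ring 2) (residue_ring 4) \<or>
      R \<simeq> RDirProd (residue_ring 2) Z2_dual \<or>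
      R \<simeq> RDirProd (residue_ring 2) F4 \<or>
      R \<simeq> RDirProd (residue_ring 2) (residue_ring 2) \<or>
      R \<simeq> RDirProd (residue_ring 2) (residue_ring 3) \<or>
      R \<simeq> RDirProd (residue_ring 3) (residue_ring 3) \<or>
      R \<simeq> RDirProd (residue_ring 3) F4 \<or>
      R \<simeq> RDirProd F4 F4" (is "?planar \<longleftrightarrow> ?list")
proof
  assume planar: ?planar
  obtain S T :: "'a ring" where R: "R \<simeq> RDirProd S T" and S: "cring S" "finite (carrier S)" "\<one>\<^bsub>S\<^esub> \<noteq> \<zero>\<^bsub>S\<^esub>"
    and T: "cring T" "finite (carrier T)" "\<one>\<^bsub>T\<^esub> \<noteq> \<zero>\<^bsub>T\<^esub>"
    using nonlocal_RDirProd[OF assms] by metis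
  have ring_R: "ring R"
    using assms(1) by (rule cring.axioms)
  \<comment> \<open>The swapped product yields the same bounds for the other factor.\<close>
  have R': "R \<simeq> RDirProd T S"
    using ring_iso_trans[OF R RDirProd_commute] .
  have "planar (upper_ideal_relation_graph (RDirProd S T))"
    using planar_graph_iso[OF ring_iso_sym[OF ring_R R]] assms(1) S(1) T(1) planar RDirProd_cring by blast
  note cardS = planar_RDirProd_card[OF S(1) T(1) S(2) T(2,3) this]
  have "planar (upper_ideal_relation_graph (RDirProd T S))"
    using planar_graph_iso[OF ring_iso_sym[OF ring_R R']] assms(1) S(1) T(1) planar RDirProd_cring by blast
  note cardT = planar_RDirProd_card[OF T(1) S(1) T(2) S(2,3) this]
  have order_2: "C \<simeq> residue_ring 2"
    if "cring C" "finite (carrier C)" "\<one>\<^bsub>C\<^esub> \<noteq> \<zero>\<^bsub>C\<^esub>" "card (carrier C) \<le> 2" for C :: "'a ring"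
  proof -
    interpret cring C by fact
    have "card {\<zero>\<^bsub>C\<^esub>, \<one>\<^bsub>C\<^esub>} \<le> card (carrier C)"
      using that(2) by (intro card_mono) auto
    then show ?thesis
      using order_2_iso that(3,4) by simp
  qed
  have S2: "S \<simeq> residue_ring 2" if "\<exists>t\<in>nonunits T. t \<noteq> \<zero>\<^bsub>T\<^esub>"
    using that cardS(2) order_2[OF S] by blast
  have T2: "T \<simeq> residue_ring 2" if "\<exists>t\<in>nonunits S. t \<noteq> \<zero>\<^bsub>S\<^esub>"
    using that cardT(2) order_2[OF T] by blast
  note cases_S = small_ring_cases[OF S cardS(1)] and cases_T = small_ring_cases[OF T cardT(1)]
  note ST = ring_iso_trans[OF R RDirProd_cong] and TS = ring_iso_trans[OF R' RDirProd_cong]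
  \<comment> \<open>If neither factor has order 2, neither has a nonzero nonunit, so both are fields
    of order 3 or 4.\<close>
  consider "S \<simeq> residue_ring 2" | "T \<simeq> residue_ring 2" |
    "S \<simeq> residue_ring 3 \<or> S \<simeq> F4" "T \<simeq> residue_ring 3 \<or> T \<simeq> F4"
    using cases_S cases_T S2 T2 by blast
  then show ?list
  proof cases
    case 1
    then show ?thesis
      using cases_T by (elim disjE conjE) (drule ST[OF 1], simp)+
  next
    case 2
    then show ?thesis
      using cases_S by (elim disjE conjE) (drule TS[OF 2], simp)+
  next
    case 3
    then show ?thesis
      \<comment> \<open>Both orders of the factors are supplied, since the list has the product of
        the fields of orders 3 and 4 in one order only.\<close>
      by (elim disjE) (frule (1) ST, frule (1) TS, simp)+
  qed
next
  assume list: ?list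
  have Z: "field (residue_ring 2)" "card (carrier (residue_ring 2)) = 2" "finite (carrier (residue_ring 2))"
    "field (residue_ring 3)" "card (carrier (residue_ring 3)) = 3" "finite (carrier (residue_ring 3))"
    "cring (residue_ring 4)" "card (carrier (residue_ring 4)) = 4"
    using field_residue_ring cring_residue_ring[of 4] by (simp_all add: residue_ring_simps)
  have F4: "field F4" "card (carrier F4) = 4" "finite (carrier F4)"
    using F4_field_order card_ge_0_finite[of "carrier F4"] by (simp_all add: order_def)
  have dual: "cring Z2_dual" "card (carrier Z2_dual) = 4"
    using Z2_dual_quadratic by (simp_all add: quadratic_over_F2_def)
  obtain a where a: "a \<in> carrier Z2_dual" "a \<noteq> \<zero>\<^bsub>Z2_dual\<^esub>" "a \<otimes>\<^bsub>Z2_dual\<^esub> a = \<zero>\<^bsub>Z2_dual\<^esub>"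
    using Z2_dual_quadratic cring.bits_simps(1) unfolding quadratic_over_F2_def by metis
  note crings = fieldE(1)[OF Z(1)] fieldE(1)[OF Z(4)] Z(7) dual(1) fieldE(1)[OF F4(1)]
  note planarI = planar_graph_iso[OF _ assms(1)]
  from list show ?planar
  proof (elim disjE)
    assume "R \<simeq> RDirProd (residue_ring 2) (RDirProd (residue_ring 2) (residue_ring 2))"
    then show ?thesis
      by (rule planarI) (intro RDirProd_cring crings planar_Z2_Z2_Z2)+
  next
    assume "R \<simeq> RDirProd (residue_ring 2) (residue_ring 4)"
    moreover have "planar (upper_ideal_relation_graph (RDirProd (residue_ring 2) (residue_ring 4)))"
      \<comment> \<open>The nonzero nilpotent element modulo 4 is 2.\<close>
      using Z by (intro planar_RDirProd_order_2_4[where t = 2]) (simp_all add: residue_ring_simps)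
    ultimately show ?thesis
      by - (rule planarI, assumption, rule RDirProd_cring; (rule crings)?)
  next
    assume "R \<simeq> RDirProd (residue_ring 2) Z2_dual"
    moreover have "planar (upper_ideal_relation_graph (RDirProd (residue_ring 2) Z2_dual))"
      by (rule planar_RDirProd_order_2_4[OF Z(1,2) dual a(1,3,2)])
    ultimately show ?thesis
      by - (rule planarI, assumption, rule RDirProd_cring; (rule crings)?)
  \<comment> \<open>The six remaining rings are products of two fields with at most four
    elements.\<close>
  qed (erule planarI; (rule RDirProd_cring planar_field_RDirProd; simp add: crings Z F4))+
qed

end
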